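(* Let $h\in\mathscr{X}(\Omega,w)'$. The equation $$(-\Delta)^{s(\cdot)}v=h$$ admits a unique solution $v\in\mathscr{X}(\Omega,w)$, and it is given by $v=\mathrm{Tr}_\Omega\,u$, where $u$ solves $$\text{minimize}\quad \mathcal{J}(u):=\frac12\|u\|^2_{\mathscr{L}_{0,L}^{1,2}(\mathcal{C},w)}-\langle h,\mathrm{Tr}_\Omega\,u\rangle_{\mathscr{X}',\mathscr{X}}\quad\text{over } u\in\mathscr{L}_{0,L}^{1,2}(\mathcal{C},w).$$
   Context: Let $\Omega\subset\mathbb{R}^N$, $N\ge 1$, be a non-empty bounded open set (no regularity of $\partial\Omega$ is assumed). Set $\mathcal{C}=\Omega\times(0,\infty)$, $\partial_L\mathcal{C}=\partial\Omega\times[0,\infty)$, $\mathcal{C}_\Omega=\mathcal{C}\cup(\Omega\times\{0\})$; points of $\mathcal{C}$ are written $X=(x,y)$ with $x\in\Omega$, $y>0$. A weight is a measurable function that is positive and finite almost everywhere. Assumptions. $s:\Omega\to\mathbb{R}$ is measurable with $s(x)\in[0,1]$ for almost all $x\in\Omega$. $\mathrm{G}_s:\Omega\to\mathbb{R}$ is a weight with $\mathrm{G}_s^{-1}\in L^1_{\mathrm{loc}}(\Omega)$; if $s(\cdot)=s\in(0,1)$ is constant, then $\mathrm{G}_s(x)=2^{2s-1}\Gamma(s)/\Gamma(1-s)$ for all $x\in\Omega$. The weight $w$ on $\mathcal{C}$ is $w(x,y)=\mathrm{G}_s(x)\,y^{1-2s(x)}$. $L^2(\mathcal{C},w)$ is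 the space of measurable $f$ with $\|f\|_{L^2(\mathcal{C},w)}=(\int_{\mathcal{C}}|f|^2w\,dX)^{1/2}<\infty$. $L^{1,2}(\mathcal{C},w)$ is the set of measurable $u:\mathcal{C}\to\mathbb{R}$ with (weak) gradient $\nabla u\in L^2(\mathcal{C},w)$, with semi-norm $\|u\|_{L^{1,2}(\mathcal{C},w)}=\|\nabla u\|_{L^2(\mathcal{C},w)}$. $C_c^\infty(\mathcal{C}_\Omega)$ is the set of $u\in C^\infty(\overline{\mathcal{C}})$ with compact support in $\mathcal{C}_\Omega$ (in particular the support does not meet $\partial_L\mathcal{C}$; $u$ need not vanish on $\Omega\times\{0\}$). $\mathscr{L}^{1,2}_{0,L}(\mathcal{C},w)$ is the completion of $C_c^\infty(\mathcal{C}_\Omega)\cap L^{1,2}(\mathcal{C},w)$ with respect to $\|\cdot\|_{L^{1,2}(\mathcal{C},w)}$, and $\mathscr{L}^{1,2}_0(\mathcal{C},w)$ is the completion of $C_c^\infty(\mathcal{C})\cap L^{1,2}(\mathcal{C},w)$ with respect to the same norm. Both are Hilbert spaces, with inner product $(\cdot,\cdot)_{\mathscr{L}_{0,L}^{1,2}(\mathcal{C},w)}$ extending $(u_1,u_2)\mapsto\int_{\mathcal{C}}w\,\nabla u_1\cdot\nabla u_2\,dX$ by continuity, and $\mathscr{L}^{1,2}_0(\mathcal{C},w)$ is a closed subspace of $\mathscr{L}^{1,2}_{0,L}(\mathcal{C},w)$. $\mathscr{X}(\Omega,w):=\mathscr{L}_{0,L}^{1,2}(\mathcal{C},w)/\mathscr{L}_0^{1,2}(\mathcal{C},w)$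 with the quotient norm (a Hilbert space), $\mathscr{X}(\Omega,w)'$ is its dual space with duality pairing $\langle\cdot,\cdot\rangle_{\mathscr{X}',\mathscr{X}}$, and $\mathrm{Tr}_\Omega:\mathscr{L}_{0,L}^{1,2}(\mathcal{C},w)\to\mathscr{X}(\Omega,w)$ is the quotient map $\mathrm{Tr}_\Omega\,u=[u]$. For $v\in\mathscr{X}(\Omega,w)$, $S(v)\in\mathscr{L}_{0,L}^{1,2}(\mathcal{C},w)$ denotes the unique minimizer of $\frac12\|u\|^2_{\mathscr{L}_{0,L}^{1,2}(\mathcal{C},w)}$ over all $u\in\mathscr{L}_{0,L}^{1,2}(\mathcal{C},w)$ with $\mathrm{Tr}_\Omega\,u=v$. The operator $(-\Delta)^{s(\cdot)}:\mathscr{X}(\Omega,w)\to\mathscr{X}(\Omega,w)'$ is defined by $$\langle(-\Delta)^{s(\cdot)}v,\mathrm{Tr}_\Omega\,\psi\rangle_{\mathscr{X}',\mathscr{X}}=(S(v),\psi)_{\mathscr{L}_{0,L}^{1,2}(\mathcal{C},w)}\qquad\text{for all }\psi\in\mathscr{L}_{0,L}^{1,2}(\mathcal{C},w).$$ *)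

theory Defs
  imports "HOL-Analysis.Analysis"
begin

section \<open>Real vector spaces with explicit carrier\<close>

text \<open>
  The spaces below depend on the domain and on the weight, so they cannot be types of class
  \<open>real_inner\<close>. The operations are only meaningful on the carrier \<open>vset\<close>.
\<close>

record 'v vspace =
  vset :: "'v set"
  vadd :: "'v \<Rightarrow> 'v \<Rightarrow> 'v"
  vscale :: "real \<Rightarrow> 'v \<Rightarrow> 'v"

record 'v ipspace = "'v vspace" +
  ip :: "'v \<Rightarrow> 'v \<Rightarrow> real"

record 'v nspace = "'v vspace" +
  nrm :: "'v \<Rightarrow> real"

definition vdiff :: "('v, 'r) vspace_scheme \<Rightarrow> 'v \<Rightarrow> 'v \<Rightarrow> 'v" where
  "vdiff V a b = vadd V a (vscale V (-1) b)"

definition ipnorm :: "('v, 'r) ipspace_scheme \<Rightarrow> 'v \<Rightarrow> real" where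
  "ipnorm V a = sqrt (ip V a a)"

subsection \<open>Quotient by a subspace\<close>

definition vquot_rel :: "('v, 'r) vspace_scheme \<Rightarrow> 'v set \<Rightarrow> ('v \<times> 'v) set" where
  "vquot_rel V K = {(a, b). a \<in> vset V \<and> b \<in> vset V \<and> vdiff V a b \<in> K}"

definition vclass :: "('v, 'r) vspace_scheme \<Rightarrow> 'v set \<Rightarrow> 'v \<Rightarrow> 'v set" where
  "vclass V K a = vquot_rel V K `` {a}"

definition vquot :: "('v, 'r) vspace_scheme \<Rightarrow> 'v set \<Rightarrow> 'v set vspace" where
  "vquot V K =
    \<lparr>vset = vset V // vquot_rel V K,
     vadd = (\<lambda>A B. \<Union>a\<in>A. \<Union>b\<in>B. vclass V K (vadd V a b)),
     vscale = (\<lambda>c A. \<Union>a\<in>A. vclass V K (vscale V c a))\<rparr>"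

definition quotient_nspace :: "('v, 'r) ipspace_scheme \<Rightarrow> 'v set \<Rightarrow> 'v set nspace" where
  "quotient_nspace V K =
    \<lparr>vset = vset (vquot V K), vadd = vadd (vquot V K), vscale = vscale (vquot V K),
     nrm = (\<lambda>A. INF a\<in>A. ipnorm V a)\<rparr>"

subsection \<open>Completion of a pre-Hilbert space\<close>

definition cauchy_space :: "('v, 'r) ipspace_scheme \<Rightarrow> (nat \<Rightarrow> 'v) vspace" where
  "cauchy_space V =
    \<lparr>vset = {a. range a \<subseteq> vset V \<and>
              (\<forall>e>0. \<exists>M. \<forall>m\<ge>M. \<forall>n\<ge>M. ipnorm V (vdiff V (a m) (a n)) < e)},
     vadd = (\<lambda>a b n. vadd V (a n) (b n)),
     vscale = (\<lambda>c a n. vscale V c (a n))\<rparr>"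

definition null_seqs :: "('v, 'r) ipspace_scheme \<Rightarrow> (nat \<Rightarrow> 'v) set" where
  "null_seqs V = {a \<in> vset (cauchy_space V). (\<lambda>n. ipnorm V (a n)) \<longlonglongrightarrow> 0}"

text \<open>
  Cauchy sequences modulo null sequences; the inner product is the extension by continuity.
\<close>

definition completion :: "('v, 'r) ipspace_scheme \<Rightarrow> (nat \<Rightarrow> 'v) set ipspace" where
  "completion V = (let Q = vquot (cauchy_space V) (null_seqs V) in
    \<lparr>vset = vset Q, vadd = vadd Q, vscale = vscale Q,
     ip = (\<lambda>A B. THE l. \<exists>a\<in>A. \<exists>b\<in>B. (\<lambda>n. ip V (a n) (b n)) \<longlonglongrightarrow> l)\<rparr>)"

text \<open>
  For a subspace \<open>W\<close> of \<open>V\<close>, the completion of \<open>W\<close> viewed inside the completion of \<open>V\<close>, i.e.\ the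
  image of the canonical isometric embedding: the classes having a Cauchy sequence from \<open>W\<close> as
  representative.
\<close>

definition completion_sub :: "('v, 'r) ipspace_scheme \<Rightarrow> 'v set \<Rightarrow> (nat \<Rightarrow> 'v) set set" where
  "completion_sub V W = {A \<in> vset (completion V). \<exists>a\<in>A. range a \<subseteq> W}"

subsection \<open>Dual space\<close>

text \<open>
  Functionals are extensional (\<open>undefined\<close> off the carrier), so that equality of functionals is
  equality on the carrier.
\<close>

definition dual :: "('v, 'r) nspace_scheme \<Rightarrow> ('v \<Rightarrow> real) set" where
  "dual N = {f \<in> extensional (vset N).
     (\<forall>a\<in>vset N. \<forall>b\<in>vset N. f (vadd N a b) = f a + f b) \<and>
     (\<forall>c. \<forall>a\<in>vset N. f (vscale N c a) = c * f a) \<and>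
     (\<exists>M. \<forall>a\<in>vset N. \<bar>f a\<bar> \<le> M * nrm N a)}"

section \<open>Smooth functions and gradients\<close>

fun ideriv :: "'a::real_normed_vector list \<Rightarrow> ('a \<Rightarrow> real) \<Rightarrow> 'a \<Rightarrow> real" where
  "ideriv [] f = f"
| "ideriv (b # bs) f = (\<lambda>X. frechet_derivative (ideriv bs f) (at X) b)"

text \<open>
  \<open>C\<^sup>\<infinity>(U)\<close> for open \<open>U\<close>: iterated partial derivatives of every order exist and are
  (Frechet-)differentiable, hence continuous.
\<close>

definition C_infty :: "'a::euclidean_space set \<Rightarrow> ('a \<Rightarrow> real) \<Rightarrow> bool" where
  "C_infty U f \<longleftrightarrow> (\<forall>bs\<in>lists Basis. ideriv bs f differentiable_on U)"

text \<open>
  \<open>C\<^sup>\<infinity>\<close> on the closure of an open \<open>U\<close>: \<open>f\<close> is smooth in \<open>U\<close> and continuous on the closure, and all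
  its partial derivatives extend continuously to the closure.
\<close>

definition C_infty_closure :: "'a::euclidean_space set \<Rightarrow> ('a \<Rightarrow> real) \<Rightarrow> bool" where
  "C_infty_closure U f \<longleftrightarrow> C_infty U f \<and> continuous_on (closure U) f \<and>
     (\<forall>bs\<in>lists Basis. \<exists>g. continuous_on (closure U) g \<and> (\<forall>X\<in>U. g X = ideriv bs f X))"

definition supp :: "('a::topological_space \<Rightarrow> real) \<Rightarrow> 'a set" where
  "supp f = closure {X. f X \<noteq> 0}"

definition Cc_infty :: "'a::euclidean_space set \<Rightarrow> ('a \<Rightarrow> real) set" where
  "Cc_infty U = {f. C_infty U f \<and> compact (supp f) \<and> supp f \<subseteq> U}"

definition grad :: "('a::euclidean_space \<Rightarrow> real) \<Rightarrow> 'a \<Rightarrow> 'a" where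
  "grad f X = (\<Sum>b\<in>Basis. frechet_derivative f (at X) b *\<^sub>R b)"

definition L2_weighted :: "'a::euclidean_space set \<Rightarrow> ('a \<Rightarrow> real) \<Rightarrow> ('a \<Rightarrow> 'b::euclidean_space) set"
  where
  "L2_weighted U w = {f. set_borel_measurable lebesgue U f \<and>
     (\<integral>\<^sup>+X\<in>U. ennreal ((norm (f X))\<^sup>2 * w X) \<partial>lebesgue) < \<infinity>}"

section \<open>The weighted spaces on the cylinder\<close>

definition cyl :: "'a set \<Rightarrow> ('a \<times> real) set" where
  "cyl \<Omega> = \<Omega> \<times> {0<..}"

definition cyl_bottom :: "'a set \<Rightarrow> ('a \<times> real) set" where
  "cyl_bottom \<Omega> = cyl \<Omega> \<union> \<Omega> \<times> {0}"

definition cyl_weight :: "('a \<Rightarrow> real) \<Rightarrow> ('a \<Rightarrow> real) \<Rightarrow> 'a \<times> real \<Rightarrow> real" where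
  "cyl_weight s G = (\<lambda>(x, y). G x * y powr (1 - 2 * s x))"

text \<open>
  Assumptions on the exponent \<open>s\<close> and the weight \<open>G\<close> (real-valued, so finiteness is automatic).
\<close>

definition admissible :: "'a::euclidean_space set \<Rightarrow> ('a \<Rightarrow> real) \<Rightarrow> ('a \<Rightarrow> real) \<Rightarrow> bool" where
  "admissible \<Omega> s G \<longleftrightarrow>
     s \<in> borel_measurable (lebesgue_on \<Omega>) \<and>
     (AE x in lebesgue_on \<Omega>. 0 \<le> s x \<and> s x \<le> 1) \<and>
     G \<in> borel_measurable (lebesgue_on \<Omega>) \<and>
     (AE x in lebesgue_on \<Omega>. 0 < G x) \<and>
     (\<forall>K. compact K \<and> K \<subseteq> \<Omega> \<longrightarrow> set_integrable lebesgue K (\<lambda>x. inverse (G x))) \<and>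
     (\<forall>c. 0 < c \<and> c < 1 \<and> (\<forall>x\<in>\<Omega>. s x = c) \<longrightarrow>
        (\<forall>x\<in>\<Omega>. G x = 2 powr (2 * c - 1) * Gamma c / Gamma (1 - c)))"

text \<open>
  Functions on the closed cylinder with compact support in \<open>cyl_bottom \<Omega>\<close>, represented by their
  extension by zero to the whole space (which need not be smooth, nor even continuous, across
  \<open>\<Omega> \<times> {0}\<close>).
\<close>

definition Cc_infty_cyl :: "'a::euclidean_space set \<Rightarrow> ('a \<times> real \<Rightarrow> real) set" where
  "Cc_infty_cyl \<Omega> =
     {u. C_infty_closure (cyl \<Omega>) u \<and> compact (supp u) \<and> supp u \<subseteq> cyl_bottom \<Omega>}"

text \<open>
  The gradient inner product on those smooth functions whose gradient is in the weighted
  \<open>L\<^sup>2\<close> space; on smooth functions the weak gradient is the classical one.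
\<close>

definition test_space ::
  "'a::euclidean_space set \<Rightarrow> ('a \<times> real \<Rightarrow> real) \<Rightarrow> ('a \<times> real \<Rightarrow> real) ipspace" where
  "test_space \<Omega> w =
    \<lparr>vset = {u \<in> Cc_infty_cyl \<Omega>. grad u \<in> L2_weighted (cyl \<Omega>) w},
     vadd = (\<lambda>u v X. u X + v X),
     vscale = (\<lambda>c u X. c * u X),
     ip = (\<lambda>u v. LINT X:cyl \<Omega>|lebesgue. w X * (grad u X \<bullet> grad v X))\<rparr>"

type_synonym 'a L_elem = "(nat \<Rightarrow> 'a \<times> real \<Rightarrow> real) set"

definition L0L :: "'a::euclidean_space set \<Rightarrow> ('a \<times> real \<Rightarrow> real) \<Rightarrow> 'a L_elem ipspace" where
  "L0L \<Omega> w = completion (test_space \<Omega> w)"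

definition L0 :: "'a::euclidean_space set \<Rightarrow> ('a \<times> real \<Rightarrow> real) \<Rightarrow> 'a L_elem set" where
  "L0 \<Omega> w = completion_sub (test_space \<Omega> w)
     {u \<in> Cc_infty (cyl \<Omega>). grad u \<in> L2_weighted (cyl \<Omega>) w}"

definition X_space :: "'a::euclidean_space set \<Rightarrow> ('a \<times> real \<Rightarrow> real) \<Rightarrow> 'a L_elem set nspace" where
  "X_space \<Omega> w = quotient_nspace (L0L \<Omega> w) (L0 \<Omega> w)"

definition Tr :: "'a::euclidean_space set \<Rightarrow> ('a \<times> real \<Rightarrow> real) \<Rightarrow> 'a L_elem \<Rightarrow> 'a L_elem set" where
  "Tr \<Omega> w u = vclass (L0L \<Omega> w) (L0 \<Omega> w) u"

section \<open>The variable-order fractional Laplacian\<close>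

definition S_ext :: "'a::euclidean_space set \<Rightarrow> ('a \<times> real \<Rightarrow> real) \<Rightarrow> 'a L_elem set \<Rightarrow> 'a L_elem"
  where
  "S_ext \<Omega> w v = (THE u. is_arg_min (\<lambda>u. 1 / 2 * (ipnorm (L0L \<Omega> w) u)\<^sup>2)
                                 (\<lambda>u. u \<in> vset (L0L \<Omega> w) \<and> Tr \<Omega> w u = v) u)"

definition frac_laplacian ::
  "'a::euclidean_space set \<Rightarrow> ('a \<times> real \<Rightarrow> real) \<Rightarrow> 'a L_elem set \<Rightarrow> ('a L_elem set \<Rightarrow> real)" where
  "frac_laplacian \<Omega> w v = (THE f. f \<in> dual (X_space \<Omega> w) \<and>
     (\<forall>\<psi>\<in>vset (L0L \<Omega> w). f (Tr \<Omega> w \<psi>) = ip (L0L \<Omega> w) (S_ext \<Omega> w v) \<psi>))"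

definition J_functional ::
  "'a::euclidean_space set \<Rightarrow> ('a \<times> real \<Rightarrow> real) \<Rightarrow> ('a L_elem set \<Rightarrow> real) \<Rightarrow> 'a L_elem \<Rightarrow> real"
  where
  "J_functional \<Omega> w h u = 1 / 2 * (ipnorm (L0L \<Omega> w) u)\<^sup>2 - h (Tr \<Omega> w u)"

end

theory Submission
  imports Defs
begin

text \<open>
  The statement is a fact about a Hilbert space \<open>H\<close>, a closed subspace \<open>K\<close> and a bounded functional
  \<open>h\<close> on the quotient \<open>H / K\<close>. Every class has a unique representative of minimal norm, and the
  representatives obtained in this way are the vectors orthogonal to \<open>K\<close>. So
  the operator sending a class \<open>v\<close> to the functional \<open>[\<psi>] \<mapsto> (S v, \<psi>)\<close>, with \<open>S v\<close> the minimal
  representative, is well defined: it is the Riesz map of the quotient, realized on the orthogonal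
  complement of \<open>K\<close>. To solve \<open>L v = h\<close>, let \<open>u\<close> minimize \<open>\<parallel>u\<parallel>\<^sup>2 / 2 - h [u]\<close> on \<open>H\<close>. Stationarity says
  \<open>(u, \<psi>) = h [\<psi>]\<close> for all \<open>\<psi>\<close>. Taking \<open>\<psi>\<close> in \<open>K\<close> shows that \<open>u\<close> is orthogonal to \<open>K\<close>, so \<open>u\<close> is
  the minimal representative of \<open>[u]\<close>, and then the same identity says \<open>L [u] = h\<close>. Conversely, a solution \<open>v\<close>
  satisfies \<open>(S v, \<psi>) = h [\<psi>] = (u, \<psi>)\<close>, whence \<open>S v = u\<close> and \<open>v = [u]\<close>. This is
  \<open>riesz_op_solution\<close>.

  Both minimization problems, the one for \<open>S\<close> and the one for \<open>u\<close>, concern a quadratic functional on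
  a nonempty, closed, midpoint-convex set, and are solved at once by the parallelogram identity
  in \<open>ex1_minimizer\<close>.

  It remains to see that the spaces on the cylinder have this form. The weighted gradient form is a
  semi-inner product on the test functions, finite by the Cauchy-Schwarz inequality as the weight is measurable
  and almost everywhere nonnegative on the cylinder (\<open>test_space_semi_inner_space\<close>). Its completion
  by Cauchy sequences modulo null sequences is a Hilbert space (\<open>completion_hilbert\<close>), and the
  classes represented by sequences from a subspace form a closed subspace
  (\<open>completion_sub_quotient\<close>); both rest on one diagonal argument (\<open>completion_diagonal\<close>).
\<close>

section \<open>Semi-inner products on a carrier\<close>

text \<open>
  The form determines vectors up to norm zero, and up to norm zero the vector space axioms follow
  from bilinearity. Closure of the carrier and bilinearity are therefore all that has to be checked,
  for the test functions as well as for equivalence classes of Cauchy sequences.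
\<close>

locale semi_inner_space =
  fixes V :: "('v, 'r) ipspace_scheme"
  assumes nonempty: "vset V \<noteq> {}"
    and add_closed [simp, intro]: "a \<in> vset V \<Longrightarrow> b \<in> vset V \<Longrightarrow> vadd V a b \<in> vset V"
    and scale_closed [simp, intro]: "a \<in> vset V \<Longrightarrow> vscale V r a \<in> vset V"
    and ip_sym: "a \<in> vset V \<Longrightarrow> b \<in> vset V \<Longrightarrow> ip V a b = ip V b a"
    and ip_add_left [simp]: "a \<in> vset V \<Longrightarrow> b \<in> vset V \<Longrightarrow> c \<in> vset V \<Longrightarrow>
      ip V (vadd V a b) c = ip V a c + ip V b c"
    and ip_scale_left [simp]: "a \<in> vset V \<Longrightarrow> b \<in> vset V \<Longrightarrow> ip V (vscale V r a) b = r * ip V a b"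
    and ip_nonneg [simp]: "a \<in> vset V \<Longrightarrow> 0 \<le> ip V a a"
begin

lemma diff_closed [simp, intro]: "a \<in> vset V \<Longrightarrow> b \<in> vset V \<Longrightarrow> vdiff V a b \<in> vset V"
  by (simp add: vdiff_def)

lemma ip_add_right [simp]:
  "a \<in> vset V \<Longrightarrow> b \<in> vset V \<Longrightarrow> c \<in> vset V \<Longrightarrow> ip V c (vadd V a b) = ip V c a + ip V c b"
  by (metis ip_sym ip_add_left add_closed)

lemma ip_scale_right [simp]:
  "a \<in> vset V \<Longrightarrow> b \<in> vset V \<Longrightarrow> ip V b (vscale V r a) = r * ip V b a"
  by (metis ip_sym ip_scale_left scale_closed)

lemma ip_diff_left [simp]:
  "a \<in> vset V \<Longrightarrow> b \<in> vset V \<Longrightarrow> c \<in> vset V \<Longrightarrow> ip V (vdiff V a b) c = ip V a c - ip V b c"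
  by (simp add: vdiff_def)

lemma ip_diff_right [simp]:
  "a \<in> vset V \<Longrightarrow> b \<in> vset V \<Longrightarrow> c \<in> vset V \<Longrightarrow> ip V c (vdiff V a b) = ip V c a - ip V c b"
  by (simp add: vdiff_def)

lemma ipnorm_nonneg [simp]: "a \<in> vset V \<Longrightarrow> 0 \<le> ipnorm V a"
  by (simp add: ipnorm_def)

lemma ipnorm_sq [simp]: "a \<in> vset V \<Longrightarrow> (ipnorm V a)\<^sup>2 = ip V a a"
  by (simp add: ipnorm_def)

lemma ipnorm_scale: "a \<in> vset V \<Longrightarrow> ipnorm V (vscale V c a) = \<bar>c\<bar> * ipnorm V a"
  by (simp add: ipnorm_def real_sqrt_mult flip: mult.assoc)

text \<open>
  The form may vanish on nonzero vectors. If \<open>b\<close> has norm zero, the quadratic polynomial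
  \<open>t \<mapsto> \<parallel>a - t b\<parallel>\<^sup>2\<close> is affine and bounded below, so its slope vanishes; otherwise its minimum
  gives the inequality.
\<close>

lemma Cauchy_Schwarz:
  assumes a: "a \<in> vset V" and b: "b \<in> vset V"
  shows "\<bar>ip V a b\<bar> \<le> ipnorm V a * ipnorm V b"
proof -
  have q: "0 \<le> ip V a a - 2 * t * ip V a b + t * t * ip V b b" for t
  proof -
    have "0 \<le> ip V (vdiff V a (vscale V t b)) (vdiff V a (vscale V t b))"
      using a b by (intro ip_nonneg) auto
    also have "\<dots> = ip V a a - 2 * t * ip V a b + t * t * ip V b b"
      using a b ip_sym[OF b a] by (simp add: algebra_simps)
    finally show ?thesis .
  qed
  have "(ip V a b)\<^sup>2 \<le> ip V a a * ip V b b"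
  proof (cases "ip V b b = 0")
    case True
    have "ip V a b = 0"
    proof (rule ccontr)
      assume n: "ip V a b \<noteq> 0"
      show False using q[of "(ip V a a + 1) / (2 * ip V a b)"] True n by simp
    qed
    then show ?thesis using True by simp
  next
    case False
    then have p: "0 < ip V b b" using ip_nonneg[OF b] by linarith
    have "0 \<le> ip V a a - (ip V a b)\<^sup>2 / ip V b b"
      using q[of "ip V a b / ip V b b"] p by (simp add: power2_eq_square)
    then show ?thesis using p by (simp add: field_simps)
  qed
  then have "sqrt ((ip V a b)\<^sup>2) \<le> sqrt (ip V a a * ip V b b)" by (rule real_sqrt_le_mono)
  then show ?thesis by (simp add: ipnorm_def real_sqrt_mult)
qed

lemma ipnorm_triangle:
  assumes a: "a \<in> vset V" and b: "b \<in> vset V"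
  shows "ipnorm V (vadd V a b) \<le> ipnorm V a + ipnorm V b"
proof (rule power2_le_imp_le)
  have "(ipnorm V (vadd V a b))\<^sup>2 = ip V a a + 2 * ip V a b + ip V b b"
    using a b ip_sym[OF b a] by simp
  also have "\<dots> \<le> ip V a a + 2 * (ipnorm V a * ipnorm V b) + ip V b b"
    using abs_le_D1[OF Cauchy_Schwarz[OF a b]] by linarith
  also have "\<dots> = (ipnorm V a + ipnorm V b)\<^sup>2" unfolding power2_sum ipnorm_sq[OF a] ipnorm_sq[OF b] by simp
  finally show "(ipnorm V (vadd V a b))\<^sup>2 \<le> (ipnorm V a + ipnorm V b)\<^sup>2" .
  show "0 \<le> ipnorm V a + ipnorm V b" by (intro add_nonneg_nonneg ipnorm_nonneg a b)
qed

abbreviation ndist :: "'v \<Rightarrow> 'v \<Rightarrow> real" where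
  "ndist a b \<equiv> ipnorm V (vdiff V a b)"

lemma ndist_commute: "a \<in> vset V \<Longrightarrow> b \<in> vset V \<Longrightarrow> ndist a b = ndist b a"
  by (simp add: ipnorm_def)

lemma ndist_self [simp]: "a \<in> vset V \<Longrightarrow> ndist a a = 0"
  by (simp add: ipnorm_def)

text \<open>
  Bilinearity turns every vector space identity into equality of all inner products. So identities
  such as \<open>a - c = (a - b) + (b - c)\<close>, which may fail on the carrier, still hold under the norm.
\<close>

lemma ipnorm_eqI:
  assumes "a \<in> vset V" "b \<in> vset V" "\<And>c. c \<in> vset V \<Longrightarrow> ip V a c = ip V b c"
  shows "ipnorm V a = ipnorm V b"
  using assms ip_sym by (metis ipnorm_def)

lemma ndist_triangle:
  assumes "a \<in> vset V" "b \<in> vset V" "c \<in> vset V"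
  shows "ndist a c \<le> ndist a b + ndist b c"
proof -
  have "ndist a c = ipnorm V (vadd V (vdiff V a b) (vdiff V b c))"
    using assms by (intro ipnorm_eqI) auto
  then show ?thesis using ipnorm_triangle[of "vdiff V a b" "vdiff V b c"] assms by auto
qed

lemma ipnorm_ndist:
  assumes "a \<in> vset V" "b \<in> vset V"
  shows "\<bar>ipnorm V a - ipnorm V b\<bar> \<le> ndist a b"
proof -
  have "ipnorm V x \<le> ndist x y + ipnorm V y" if "x \<in> vset V" "y \<in> vset V" for x y
  proof -
    have "ipnorm V x = ipnorm V (vadd V (vdiff V x y) y)"
      using that by (intro ipnorm_eqI) auto
    then show ?thesis using ipnorm_triangle[of "vdiff V x y" y] that by auto
  qed
  from this[of a b] this[of b a] show ?thesis using assms ndist_commute[of a b] by auto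
qed

lemma ndist_add:
  assumes "a \<in> vset V" "b \<in> vset V" "a' \<in> vset V" "b' \<in> vset V"
  shows "ndist (vadd V a b) (vadd V a' b') \<le> ndist a a' + ndist b b'"
proof -
  have "ndist (vadd V a b) (vadd V a' b') = ipnorm V (vadd V (vdiff V a a') (vdiff V b b'))"
    using assms by (intro ipnorm_eqI) auto
  then show ?thesis using ipnorm_triangle[of "vdiff V a a'" "vdiff V b b'"] assms by auto
qed

lemma ndist_scale:
  assumes "a \<in> vset V" "a' \<in> vset V"
  shows "ndist (vscale V c a) (vscale V c a') = \<bar>c\<bar> * ndist a a'"
proof -
  have "ndist (vscale V c a) (vscale V c a') = ipnorm V (vscale V c (vdiff V a a'))"
    using assms by (intro ipnorm_eqI) (auto simp: algebra_simps)
  then show ?thesis using assms by (simp add: ipnorm_scale)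
qed

lemma ndist_diff:
  assumes "a \<in> vset V" "b \<in> vset V" "a' \<in> vset V" "b' \<in> vset V"
  shows "ndist (vdiff V a b) (vdiff V a' b') \<le> ndist a a' + ndist b b'"
  using ndist_add[of a "vscale V (-1) b" a' "vscale V (-1) b'"] ndist_scale[of b b' "-1"] assms
  by (simp add: vdiff_def)

text \<open>The polarization identity reduces convergence of inner products to convergence of norms.\<close>

lemma polarization:
  assumes "a \<in> vset V" "b \<in> vset V"
  shows "ip V a b = ((ipnorm V (vadd V a b))\<^sup>2 - (ndist a b)\<^sup>2) / 4"
  using assms ip_sym[of a b] by simp

lemma tendsto_ip:
  assumes "\<And>n. x n \<in> vset V" "a \<in> vset V" "(\<lambda>n. ndist (x n) a) \<longlonglongrightarrow> 0" "b \<in> vset V"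
  shows "(\<lambda>n. ip V (x n) b) \<longlonglongrightarrow> ip V a b"
proof -
  have "(\<lambda>n. ndist (x n) a * ipnorm V b) \<longlonglongrightarrow> 0 * ipnorm V b"
    by (intro tendsto_intros assms)
  then have 0: "(\<lambda>n. ndist (x n) a * ipnorm V b) \<longlonglongrightarrow> 0" by simp
  have "norm (ip V (x n) b - ip V a b) \<le> ndist (x n) a * ipnorm V b" for n
    using Cauchy_Schwarz[OF diff_closed[OF assms(1,2)] assms(4), of n]
    by (simp add: assms(1,2,4))
  then have "(\<lambda>n. ip V (x n) b - ip V a b) \<longlonglongrightarrow> 0"
    by (intro Lim_null_comparison[OF _ 0] always_eventually allI)
  then show ?thesis by (simp add: LIM_zero_iff)
qed

lemma tendsto_ipnorm:
  assumes "\<And>n. x n \<in> vset V" "a \<in> vset V" "(\<lambda>n. ndist (x n) a) \<longlonglongrightarrow> 0"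
  shows "(\<lambda>n. ipnorm V (x n)) \<longlonglongrightarrow> ipnorm V a"
proof -
  have "(\<lambda>n. ipnorm V (x n) - ipnorm V a) \<longlonglongrightarrow> 0"
    using ipnorm_ndist[OF assms(1,2)]
    by (intro Lim_null_comparison[OF _ assms(3)] always_eventually allI) simp
  then show ?thesis by (simp add: LIM_zero_iff)
qed

end


section \<open>Quotients by a congruence\<close>

text \<open>
  Quotient operations are defined as unions over all representatives; on a congruence all members
  of the union coincide, so the operations act on any chosen representatives.
\<close>

locale vspace_congruence =
  fixes V :: "('v, 'r) vspace_scheme" and K :: "'v set"
  assumes cong_equiv: "equiv (vset V) (vquot_rel V K)"
    and cong_add: "(a, a') \<in> vquot_rel V K \<Longrightarrow> (b, b') \<in> vquot_rel V K \<Longrightarrow>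
      (vadd V a b, vadd V a' b') \<in> vquot_rel V K"
    and cong_scale: "(a, a') \<in> vquot_rel V K \<Longrightarrow> (vscale V r a, vscale V r a') \<in> vquot_rel V K"
begin

lemma vclass_eq_iff:
  "a \<in> vset V \<Longrightarrow> b \<in> vset V \<Longrightarrow> vclass V K a = vclass V K b \<longleftrightarrow> vdiff V a b \<in> K"
  unfolding vclass_def by (subst eq_equiv_class_iff[OF cong_equiv]) (auto simp: vquot_rel_def)

lemma vset_vquot: "vset (vquot V K) = vclass V K ` vset V"
  by (auto simp: vquot_def quotient_def vclass_def)

lemma vclass_eq: "(a, b) \<in> vquot_rel V K \<Longrightarrow> vclass V K b = vclass V K a"
  unfolding vclass_def using equiv_class_eq[OF cong_equiv] by blast

lemma mem_vclass:
  assumes "a \<in> vset V"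
  shows "b \<in> vclass V K a \<longleftrightarrow> b \<in> vset V \<and> vclass V K b = vclass V K a"
proof
  assume "b \<in> vclass V K a"
  then have r: "(a, b) \<in> vquot_rel V K" by (simp add: vclass_def)
  then show "b \<in> vset V \<and> vclass V K b = vclass V K a"
    using vclass_eq[OF r] by (simp add: vquot_rel_def)
next
  assume "b \<in> vset V \<and> vclass V K b = vclass V K a"
  then have "b \<in> vset V" "b \<in> vclass V K b \<longrightarrow> b \<in> vclass V K a" by auto
  then show "b \<in> vclass V K a" using equiv_class_self[OF cong_equiv] by (simp add: vclass_def)
qed

lemma vadd_vquot:
  assumes "a \<in> vset V" "b \<in> vset V"
  shows "vadd (vquot V K) (vclass V K a) (vclass V K b) = vclass V K (vadd V a b)"
proof -
  have "vclass V K (vadd V a' b') = vclass V K (vadd V a b)"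
    if "a' \<in> vclass V K a" "b' \<in> vclass V K b" for a' b'
    using that by (intro vclass_eq cong_add) (simp_all add: vclass_def)
  moreover have "a \<in> vclass V K a" "b \<in> vclass V K b" using assms by (simp_all add: mem_vclass)
  ultimately have "(\<Union>a'\<in>vclass V K a. \<Union>b'\<in>vclass V K b. vclass V K (vadd V a' b')) = vclass V K (vadd V a b)"
    by (intro UN_constant_eq ballI)
  then show ?thesis by (simp add: vquot_def)
qed

lemma vscale_vquot:
  assumes "a \<in> vset V"
  shows "vscale (vquot V K) c (vclass V K a) = vclass V K (vscale V c a)"
proof -
  have "vclass V K (vscale V c a') = vclass V K (vscale V c a)" if "a' \<in> vclass V K a" for a'
    using that by (intro vclass_eq cong_scale) (simp_all add: vclass_def)
  moreover have "a \<in> vclass V K a" using assms by (simp add: mem_vclass)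
  ultimately have "(\<Union>a'\<in>vclass V K a. vclass V K (vscale V c a')) = vclass V K (vscale V c a)"
    by (intro UN_constant_eq ballI)
  then show ?thesis by (simp add: vquot_def)
qed

end


section \<open>The completion is a Hilbert space\<close>

locale hilbert_carrier = semi_inner_space +
  assumes definite: "a \<in> vset V \<Longrightarrow> b \<in> vset V \<Longrightarrow> ndist a b = 0 \<Longrightarrow> a = b"
    and complete: "x \<in> vset (cauchy_space V) \<Longrightarrow> \<exists>a\<in>vset V. (\<lambda>n. ndist (x n) a) \<longlonglongrightarrow> 0"

context semi_inner_space
begin

lemma cauchy_iff:
  "x \<in> vset (cauchy_space V) \<longleftrightarrow>
    (\<forall>n. x n \<in> vset V) \<and> (\<forall>e>0. \<exists>M. \<forall>m\<ge>M. \<forall>n\<ge>M. ndist (x m) (x n) < e)"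
  by (auto simp: cauchy_space_def)

lemma cauchy_in: "x \<in> vset (cauchy_space V) \<Longrightarrow> x n \<in> vset V"
  by (simp add: cauchy_iff)

lemma cauchy_ops [simp]:
  "vadd (cauchy_space V) x y n = vadd V (x n) (y n)"
  "vscale (cauchy_space V) c x n = vscale V c (x n)"
  "vdiff (cauchy_space V) x y n = vdiff V (x n) (y n)"
  by (simp_all add: cauchy_space_def vdiff_def)

lemma cauchy_dominated:
  assumes x: "x \<in> vset (cauchy_space V)" and y: "y \<in> vset (cauchy_space V)"
    and z: "\<And>n. z n \<in> vset V"
    and le: "\<And>m n. ndist (z m) (z n) \<le> C * ndist (x m) (x n) + ndist (y m) (y n)"
  shows "z \<in> vset (cauchy_space V)"
  unfolding cauchy_iff
proof (intro conjI allI impI z)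
  fix e :: real assume e: "0 < e"
  define e' where "e' = e / (2 * (\<bar>C\<bar> + 1))"
  have e': "0 < e'" using e by (simp add: e'_def)
  obtain M1 where M1: "\<And>m n. m \<ge> M1 \<Longrightarrow> n \<ge> M1 \<Longrightarrow> ndist (x m) (x n) < e'"
    using x e' unfolding cauchy_iff by blast
  obtain M2 where M2: "\<And>m n. m \<ge> M2 \<Longrightarrow> n \<ge> M2 \<Longrightarrow> ndist (y m) (y n) < e / 2"
    using y e unfolding cauchy_iff by (meson half_gt_zero)
  have "ndist (z m) (z n) < e" if "m \<ge> max M1 M2" "n \<ge> max M1 M2" for m n
  proof -
    have "C * ndist (x m) (x n) \<le> (\<bar>C\<bar> + 1) * e'"
      using M1[of m n] that x by (intro mult_mono) (auto simp: cauchy_in less_imp_le)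
    also have "\<dots> = e / 2"
      unfolding e'_def by (simp add: field_simps add_nonneg_eq_0_iff)
    finally show ?thesis using le[of m n] M2[of m n] that by auto
  qed
  then show "\<exists>M. \<forall>m\<ge>M. \<forall>n\<ge>M. ndist (z m) (z n) < e" by blast
qed

lemma const_cauchy: "a \<in> vset V \<Longrightarrow> (\<lambda>_. a) \<in> vset (cauchy_space V)"
  by (simp add: cauchy_iff)

lemma cauchy_add_closed:
  assumes "x \<in> vset (cauchy_space V)" "y \<in> vset (cauchy_space V)"
  shows "vadd (cauchy_space V) x y \<in> vset (cauchy_space V)"
  using assms ndist_add by (intro cauchy_dominated[OF assms, where C = 1]) (auto simp: cauchy_in)

lemma cauchy_scale_closed:
  assumes "x \<in> vset (cauchy_space V)"
  shows "vscale (cauchy_space V) c x \<in> vset (cauchy_space V)"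
proof (rule cauchy_dominated[where C = "\<bar>c\<bar>"])
  show "x \<in> vset (cauchy_space V)" by fact
  show "(\<lambda>_. x 0) \<in> vset (cauchy_space V)" using assms by (intro const_cauchy cauchy_in)
qed (use assms in \<open>auto simp: cauchy_in ndist_scale\<close>)

lemma cauchy_diff_closed:
  assumes "x \<in> vset (cauchy_space V)" "y \<in> vset (cauchy_space V)"
  shows "vdiff (cauchy_space V) x y \<in> vset (cauchy_space V)"
  unfolding vdiff_def by (intro cauchy_add_closed cauchy_scale_closed assms)

lemma convergent_ipnorm:
  assumes x: "x \<in> vset (cauchy_space V)"
  shows "convergent (\<lambda>n. ipnorm V (x n))"
proof (rule Cauchy_convergent, rule metric_CauchyI)
  fix e :: real assume "0 < e"
  then obtain M where M: "\<And>m n. m \<ge> M \<Longrightarrow> n \<ge> M \<Longrightarrow> ndist (x m) (x n) < e"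
    using x unfolding cauchy_iff by blast
  have "dist (ipnorm V (x m)) (ipnorm V (x n)) < e" if "m \<ge> M" "n \<ge> M" for m n
    using ipnorm_ndist[of "x m" "x n"] M[OF that] x by (simp add: dist_real_def cauchy_in)
  then show "\<exists>M. \<forall>m\<ge>M. \<forall>n\<ge>M. dist (ipnorm V (x m)) (ipnorm V (x n)) < e" by blast
qed

text \<open>
  Norms of Cauchy sequences form real Cauchy sequences, and sums and differences of Cauchy
  sequences are Cauchy, so polarization applies.
\<close>

lemma convergent_ip:
  assumes x: "x \<in> vset (cauchy_space V)" and y: "y \<in> vset (cauchy_space V)"
  shows "convergent (\<lambda>n. ip V (x n) (y n))"
proof -
  obtain p where p: "(\<lambda>n. ipnorm V (vadd V (x n) (y n))) \<longlonglongrightarrow> p"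
    using convergent_ipnorm[OF cauchy_add_closed[OF x y]] by (auto simp: convergent_def)
  obtain q where q: "(\<lambda>n. ndist (x n) (y n)) \<longlonglongrightarrow> q"
    using convergent_ipnorm[OF cauchy_diff_closed[OF x y]] by (auto simp: convergent_def)
  have "(\<lambda>n. ((ipnorm V (vadd V (x n) (y n)))\<^sup>2 - (ndist (x n) (y n))\<^sup>2) / 4) \<longlonglongrightarrow> (p\<^sup>2 - q\<^sup>2) / 4"
    by (intro tendsto_intros p q) auto
  moreover have "(\<lambda>n. ((ipnorm V (vadd V (x n) (y n)))\<^sup>2 - (ndist (x n) (y n))\<^sup>2) / 4) = (\<lambda>n. ip V (x n) (y n))"
    by (intro ext polarization[symmetric] cauchy_in x y)
  ultimately show ?thesis by (auto simp: convergent_def)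
qed

lemma null_rel_iff:
  "(x, y) \<in> vquot_rel (cauchy_space V) (null_seqs V) \<longleftrightarrow>
    x \<in> vset (cauchy_space V) \<and> y \<in> vset (cauchy_space V) \<and> (\<lambda>n. ndist (x n) (y n)) \<longlonglongrightarrow> 0"
  by (auto simp: vquot_rel_def null_seqs_def cauchy_diff_closed)

lemma null_squeeze:
  assumes "f \<longlonglongrightarrow> (0 :: real)" "g \<longlonglongrightarrow> 0" "\<And>n. x n \<in> vset V" "\<And>n. ipnorm V (x n) \<le> f n + g n"
  shows "(\<lambda>n. ipnorm V (x n)) \<longlonglongrightarrow> 0"
proof (rule tendsto_sandwich[where f = "\<lambda>_. 0" and h = "\<lambda>n. f n + g n"])
  show "(\<lambda>n. f n + g n) \<longlonglongrightarrow> 0" using tendsto_add[OF assms(1,2)] by simp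
qed (use assms in auto)

sublocale cauchy: vspace_congruence "cauchy_space V" "null_seqs V"
proof
  show "equiv (vset (cauchy_space V)) (vquot_rel (cauchy_space V) (null_seqs V))"
  proof (rule equivI)
    show "vquot_rel (cauchy_space V) (null_seqs V) \<subseteq> vset (cauchy_space V) \<times> vset (cauchy_space V)"
      by (auto simp: vquot_rel_def)
    show "refl_on (vset (cauchy_space V)) (vquot_rel (cauchy_space V) (null_seqs V))"
      by (auto simp: refl_on_def null_rel_iff cauchy_in)
    show "sym (vquot_rel (cauchy_space V) (null_seqs V))"
      by (auto simp: sym_def null_rel_iff cauchy_in ndist_commute)
    show "trans (vquot_rel (cauchy_space V) (null_seqs V))"
    proof (rule transI)
      fix x y z
      assume "(x, y) \<in> vquot_rel (cauchy_space V) (null_seqs V)"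
        and "(y, z) \<in> vquot_rel (cauchy_space V) (null_seqs V)"
      then show "(x, z) \<in> vquot_rel (cauchy_space V) (null_seqs V)"
        unfolding null_rel_iff using ndist_triangle
        by (auto intro!: null_squeeze[where f = "\<lambda>n. ndist (x n) (y n)" and g = "\<lambda>n. ndist (y n) (z n)"]
            simp: cauchy_in)
    qed
  qed
next
  fix x x' y y'
  assume "(x, x') \<in> vquot_rel (cauchy_space V) (null_seqs V)"
    and "(y, y') \<in> vquot_rel (cauchy_space V) (null_seqs V)"
  then show "(vadd (cauchy_space V) x y, vadd (cauchy_space V) x' y')
      \<in> vquot_rel (cauchy_space V) (null_seqs V)"
    unfolding null_rel_iff using ndist_add
    by (auto intro!: null_squeeze[where f = "\<lambda>n. ndist (x n) (x' n)" and g = "\<lambda>n. ndist (y n) (y' n)"]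
        simp: cauchy_in cauchy_add_closed)
next
  fix x x' c
  assume "(x, x') \<in> vquot_rel (cauchy_space V) (null_seqs V)"
  then show "(vscale (cauchy_space V) c x, vscale (cauchy_space V) c x')
      \<in> vquot_rel (cauchy_space V) (null_seqs V)"
    unfolding null_rel_iff
    by (auto simp: cauchy_in cauchy_scale_closed ndist_scale intro: tendsto_mult_right_zero)
qed

abbreviation cls :: "(nat \<Rightarrow> 'v) \<Rightarrow> (nat \<Rightarrow> 'v) set" where
  "cls \<equiv> vclass (cauchy_space V) (null_seqs V)"

lemma vset_completion: "vset (completion V) = cls ` vset (cauchy_space V)"
  by (simp add: completion_def Let_def cauchy.vset_vquot)

lemma cls_eq_iff:
  "x \<in> vset (cauchy_space V) \<Longrightarrow> y \<in> vset (cauchy_space V) \<Longrightarrow>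
    cls x = cls y \<longleftrightarrow> (\<lambda>n. ndist (x n) (y n)) \<longlonglongrightarrow> 0"
  by (simp add: cauchy.vclass_eq_iff) (simp add: null_seqs_def cauchy_diff_closed)

lemma vadd_completion:
  "x \<in> vset (cauchy_space V) \<Longrightarrow> y \<in> vset (cauchy_space V) \<Longrightarrow>
    vadd (completion V) (cls x) (cls y) = cls (vadd (cauchy_space V) x y)"
  by (simp add: completion_def Let_def cauchy.vadd_vquot)

lemma vscale_completion:
  "x \<in> vset (cauchy_space V) \<Longrightarrow>
    vscale (completion V) c (cls x) = cls (vscale (cauchy_space V) c x)"
  by (simp add: completion_def Let_def cauchy.vscale_vquot)

lemma vdiff_completion:
  "x \<in> vset (cauchy_space V) \<Longrightarrow> y \<in> vset (cauchy_space V) \<Longrightarrow>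
    vdiff (completion V) (cls x) (cls y) = cls (vdiff (cauchy_space V) x y)"
  by (simp add: vdiff_def vadd_completion vscale_completion cauchy_scale_closed)

lemma ipnorm_null_tendsto:
  assumes "x \<in> vset (cauchy_space V)" "y \<in> vset (cauchy_space V)"
    and "(\<lambda>n. ndist (x n) (y n)) \<longlonglongrightarrow> 0" "(\<lambda>n. ipnorm V (y n)) \<longlonglongrightarrow> l"
  shows "(\<lambda>n. ipnorm V (x n)) \<longlonglongrightarrow> l"
proof -
  have "(\<lambda>n. ipnorm V (x n) - ipnorm V (y n)) \<longlonglongrightarrow> 0"
    using ipnorm_ndist[OF cauchy_in[OF assms(1)] cauchy_in[OF assms(2)]]
    by (intro Lim_null_comparison[OF _ assms(3)] always_eventually allI) simp
  from tendsto_add[OF this assms(4)] show ?thesis by simp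
qed

text \<open>
  The limit of the inner products does not depend on the representatives: by polarization it is
  determined by the limits of the norms of the sum and of the difference, and these change by null
  sequences. Hence the definite description in the inner product of the completion denotes this
  limit.
\<close>

lemma ip_null_tendsto:
  assumes x: "x \<in> vset (cauchy_space V)" "x' \<in> vset (cauchy_space V)" "cls x' = cls x"
    and y: "y \<in> vset (cauchy_space V)" "y' \<in> vset (cauchy_space V)" "cls y' = cls y"
    and l: "(\<lambda>n. ip V (x n) (y n)) \<longlonglongrightarrow> l"
  shows "(\<lambda>n. ip V (x' n) (y' n)) \<longlonglongrightarrow> l"
proof -
  have add: "cls (vadd (cauchy_space V) x' y') = cls (vadd (cauchy_space V) x y)"
    by (simp only: vadd_completion[symmetric] x y)
  have diff: "cls (vdiff (cauchy_space V) x' y') = cls (vdiff (cauchy_space V) x y)"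
    by (simp only: vdiff_completion[symmetric] x y)
  note cl = cauchy_add_closed cauchy_diff_closed x(1,2) y(1,2)
  obtain p where p: "(\<lambda>n. ipnorm V (vadd (cauchy_space V) x y n)) \<longlonglongrightarrow> p"
    using convergent_ipnorm[OF cl(1)[OF cl(3,5)]] by (auto simp: convergent_def)
  obtain q where q: "(\<lambda>n. ipnorm V (vdiff (cauchy_space V) x y n)) \<longlonglongrightarrow> q"
    using convergent_ipnorm[OF cl(2)[OF cl(3,5)]] by (auto simp: convergent_def)
  have p': "(\<lambda>n. ipnorm V (vadd (cauchy_space V) x' y' n)) \<longlonglongrightarrow> p"
    by (rule ipnorm_null_tendsto[OF _ _ _ p]) (use add in \<open>simp_all add: cl cls_eq_iff del: cauchy_ops\<close>)
  have q': "(\<lambda>n. ipnorm V (vdiff (cauchy_space V) x' y' n)) \<longlonglongrightarrow> q"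
    by (rule ipnorm_null_tendsto[OF _ _ _ q]) (use diff in \<open>simp_all add: cl cls_eq_iff del: cauchy_ops\<close>)
  have lim: "(\<lambda>n. ip V (a n) (b n)) \<longlonglongrightarrow> (p\<^sup>2 - q\<^sup>2) / 4"
    if "(\<lambda>n. ipnorm V (vadd (cauchy_space V) a b n)) \<longlonglongrightarrow> p"
      "(\<lambda>n. ipnorm V (vdiff (cauchy_space V) a b n)) \<longlonglongrightarrow> q"
      "a \<in> vset (cauchy_space V)" "b \<in> vset (cauchy_space V)" for a b
  proof -
    have "(\<lambda>n. ((ipnorm V (vadd V (a n) (b n)))\<^sup>2 - (ndist (a n) (b n))\<^sup>2) / 4) \<longlonglongrightarrow> (p\<^sup>2 - q\<^sup>2) / 4"
      using that(1,2) by (intro tendsto_intros) auto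
    moreover have "ip V (a n) (b n) = ((ipnorm V (vadd V (a n) (b n)))\<^sup>2 - (ndist (a n) (b n))\<^sup>2) / 4" for n
      by (intro polarization cauchy_in that)
    ultimately show ?thesis by (simp only:)
  qed
  have "l = (p\<^sup>2 - q\<^sup>2) / 4" using LIMSEQ_unique[OF l lim[OF p q x(1) y(1)]] .
  then show ?thesis using lim[OF p' q' x(2) y(2)] by (simp only:)
qed

lemma ip_completion:
  assumes x: "x \<in> vset (cauchy_space V)" and y: "y \<in> vset (cauchy_space V)"
  shows "(\<lambda>n. ip V (x n) (y n)) \<longlonglongrightarrow> ip (completion V) (cls x) (cls y)"
proof -
  obtain l where l: "(\<lambda>n. ip V (x n) (y n)) \<longlonglongrightarrow> l"
    using convergent_ip[OF x y] by (auto simp: convergent_def)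
  have "ip (completion V) (cls x) (cls y) =
      (THE l. \<exists>a\<in>cls x. \<exists>b\<in>cls y. (\<lambda>n. ip V (a n) (b n)) \<longlonglongrightarrow> l)"
    by (simp add: completion_def Let_def)
  also have "\<dots> = l"
  proof (rule the_equality)
    show "\<exists>a\<in>cls x. \<exists>b\<in>cls y. (\<lambda>n. ip V (a n) (b n)) \<longlonglongrightarrow> l"
      using cauchy.mem_vclass[OF x, of x] cauchy.mem_vclass[OF y, of y] l x y by auto
    fix l' assume "\<exists>a\<in>cls x. \<exists>b\<in>cls y. (\<lambda>n. ip V (a n) (b n)) \<longlonglongrightarrow> l'"
    then obtain a b where ab: "a \<in> cls x" "b \<in> cls y" "(\<lambda>n. ip V (a n) (b n)) \<longlonglongrightarrow> l'" by blast
    have "(\<lambda>n. ip V (a n) (b n)) \<longlonglongrightarrow> l"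
      using ab x y by (intro ip_null_tendsto[OF x _ _ y _ _ l]) (auto simp: cauchy.mem_vclass)
    then show "l' = l" using LIMSEQ_unique[OF ab(3)] by simp
  qed
  finally show ?thesis using l by simp
qed

lemma ip_completion_eqI:
  assumes "x \<in> vset (cauchy_space V)" "y \<in> vset (cauchy_space V)" "(\<lambda>n. ip V (x n) (y n)) \<longlonglongrightarrow> l"
  shows "ip (completion V) (cls x) (cls y) = l"
  using LIMSEQ_unique[OF ip_completion[OF assms(1,2)] assms(3)] .

lemma completion_semi_inner_space: "semi_inner_space (completion V)"
proof
  show "vset (completion V) \<noteq> {}"
    using nonempty const_cauchy by (auto simp: vset_completion)
next
  fix A B assume "A \<in> vset (completion V)" "B \<in> vset (completion V)"
  then obtain x y where xy: "x \<in> vset (cauchy_space V)" "A = cls x" "y \<in> vset (cauchy_space V)" "B = cls y"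
    by (auto simp: vset_completion)
  show "vadd (completion V) A B \<in> vset (completion V)"
    using xy by (auto simp: vset_completion vadd_completion cauchy_add_closed)
  have "(\<lambda>n. ip V (x n) (y n)) \<longlonglongrightarrow> ip (completion V) B A"
    using ip_completion[OF xy(3,1)] unfolding xy(2,4) ip_sym[OF cauchy_in[OF xy(3)] cauchy_in[OF xy(1)]] .
  then show "ip (completion V) A B = ip (completion V) B A"
    unfolding xy(2,4) by (rule ip_completion_eqI[OF xy(1,3)])
  show "ip (completion V) (vscale (completion V) c A) B = c * ip (completion V) A B" for c
    unfolding xy(2,4) vscale_completion[OF xy(1)]
  proof (rule ip_completion_eqI[OF cauchy_scale_closed[OF xy(1)] xy(3)])
    show "(\<lambda>n. ip V (vscale (cauchy_space V) c x n) (y n)) \<longlonglongrightarrow> c * ip (completion V) (cls x) (cls y)"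
      using tendsto_mult_left[OF ip_completion[OF xy(1,3)], of c] by (simp add: cauchy_in xy(1,3))
  qed
  fix C assume "C \<in> vset (completion V)"
  then obtain z where z: "z \<in> vset (cauchy_space V)" "C = cls z" by (auto simp: vset_completion)
  show "ip (completion V) (vadd (completion V) A B) C =
      ip (completion V) A C + ip (completion V) B C"
    unfolding xy(2,4) z(2) vadd_completion[OF xy(1,3)]
  proof (rule ip_completion_eqI[OF cauchy_add_closed[OF xy(1,3)] z(1)])
    show "(\<lambda>n. ip V (vadd (cauchy_space V) x y n) (z n)) \<longlonglongrightarrow>
        ip (completion V) (cls x) (cls z) + ip (completion V) (cls y) (cls z)"
      using tendsto_add[OF ip_completion[OF xy(1) z(1)] ip_completion[OF xy(3) z(1)]]
      by (simp add: cauchy_in xy(1,3) z(1))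
  qed
next
  fix A c assume "A \<in> vset (completion V)"
  then obtain x where x: "x \<in> vset (cauchy_space V)" "A = cls x" by (auto simp: vset_completion)
  show "vscale (completion V) c A \<in> vset (completion V)"
    using x by (auto simp: vset_completion vscale_completion cauchy_scale_closed)
  show "0 \<le> ip (completion V) A A"
    using LIMSEQ_le_const[OF ip_completion[OF x(1) x(1)], of 0] x by (auto simp: cauchy_in)
qed

lemma ipnorm_completion:
  assumes "x \<in> vset (cauchy_space V)"
  shows "(\<lambda>n. ipnorm V (x n)) \<longlonglongrightarrow> ipnorm (completion V) (cls x)"
  unfolding ipnorm_def by (intro tendsto_intros ip_completion assms)

lemma ndist_completion:
  assumes "x \<in> vset (cauchy_space V)" "y \<in> vset (cauchy_space V)"
  shows "(\<lambda>n. ndist (x n) (y n)) \<longlonglongrightarrow> ipnorm (completion V) (vdiff (completion V) (cls x) (cls y))"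
  using ipnorm_completion[OF cauchy_diff_closed[OF assms]] by (simp add: vdiff_completion assms)

text \<open>
  Diagonal argument. Replacing each term of a Cauchy sequence of classes by one late entry of a
  representative changes it by at most \<open>1/(k+1)\<close>, so these entries form a Cauchy sequence in the
  original space, and its class is the limit. Since the entries come from the representatives
  themselves, the same argument shows completeness and the closedness of completed subspaces.
\<close>

lemma completion_diagonal:
  assumes A: "A \<in> vset (cauchy_space (completion V))"
    and r: "\<And>k. r k \<in> A k"
  shows "\<exists>b \<in> vset (cauchy_space V). (\<forall>k. \<exists>n. b k = r k n) \<and>
    (\<lambda>k. ipnorm (completion V) (vdiff (completion V) (A k) (cls b))) \<longlonglongrightarrow> 0"
proof -
  interpret C: semi_inner_space "completion V" by (rule completion_semi_inner_space)
  have Ain: "A k \<in> vset (completion V)" for k using A by (rule C.cauchy_in)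
  have r12: "r k \<in> vset (cauchy_space V) \<and> A k = cls (r k)" for k
  proof -
    obtain x where "x \<in> vset (cauchy_space V)" "A k = cls x"
      using Ain[of k] unfolding vset_completion by blast
    then show ?thesis using r[of k] cauchy.mem_vclass[of x "r k"] by simp
  qed
  then have r1: "r k \<in> vset (cauchy_space V)" and r2: "A k = cls (r k)" for k by blast+
  have "\<exists>N. \<forall>n\<ge>N. ndist (r k n) (r k N) < inverse (real (Suc k))" for k
  proof -
    have "0 < inverse (real (Suc k))" by simp
    then obtain M where "\<forall>m\<ge>M. \<forall>n\<ge>M. ndist (r k m) (r k n) < inverse (real (Suc k))"
      using r1[of k] unfolding cauchy_iff by blast
    then show ?thesis by blast
  qed
  then obtain N where N: "\<And>k n. n \<ge> N k \<Longrightarrow> ndist (r k n) (r k (N k)) < inverse (real (Suc k))"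
    by metis
  define b where "b k = r k (N k)" for k
  have bin: "b k \<in> vset V" for k unfolding b_def by (rule cauchy_in[OF r1])
  define j where "j k = cls (\<lambda>_. b k)" for k
  have jin: "j k \<in> vset (completion V)" for k
    unfolding j_def vset_completion by (intro imageI const_cauchy bin)
  have Aj: "C.ndist (A k) (j k) \<le> inverse (real (Suc k))" for k
  proof (rule LIMSEQ_le_const2)
    show "(\<lambda>n. ndist (r k n) (b k)) \<longlonglongrightarrow> C.ndist (A k) (j k)"
      unfolding r2 j_def by (intro ndist_completion r1 const_cauchy bin)
    show "\<exists>M. \<forall>n\<ge>M. ndist (r k n) (b k) \<le> inverse (real (Suc k))"
      unfolding b_def using N[THEN less_imp_le] by (intro exI[of _ "N k"]) simp
  qed
  have jj: "C.ndist (j k) (j l) = ndist (b k) (b l)" for k l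
    using LIMSEQ_unique[OF ndist_completion[OF const_cauchy[OF bin[of k]] const_cauchy[OF bin[of l]]] tendsto_const]
    by (simp add: j_def)
  have b: "b \<in> vset (cauchy_space V)"
    unfolding cauchy_iff
  proof (intro conjI allI impI bin)
    fix e :: real assume e: "0 < e"
    then have e3: "0 < e / 3" by simp
    obtain M1 where M1: "\<And>m n. m \<ge> M1 \<Longrightarrow> n \<ge> M1 \<Longrightarrow> C.ndist (A m) (A n) < e / 3"
      using A e3 unfolding C.cauchy_iff by blast
    obtain M2 where M2: "inverse (real (Suc M2)) < e / 3" using e3 reals_Archimedean by blast
    have M2': "inverse (real (Suc n)) < e / 3" if "n \<ge> M2" for n
      using that by (intro le_less_trans[OF _ M2] le_imp_inverse_le) auto
    have "ndist (b m) (b n) < e" if "m \<ge> max M1 M2" "n \<ge> max M1 M2" for m n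
    proof -
      have "ndist (b m) (b n) \<le> C.ndist (j m) (A m) + C.ndist (A m) (j n)"
        unfolding jj[symmetric] by (intro C.ndist_triangle jin Ain)
      also have "C.ndist (A m) (j n) \<le> C.ndist (A m) (A n) + C.ndist (A n) (j n)"
        by (intro C.ndist_triangle jin Ain)
      finally show ?thesis
        using Aj[of m] Aj[of n] M1[of m n] M2'[of m] M2'[of n] that C.ndist_commute[OF jin Ain, of m m]
        by auto
    qed
    then show "\<exists>M. \<forall>m\<ge>M. \<forall>n\<ge>M. ndist (b m) (b n) < e" by blast
  qed
  have Bin: "cls b \<in> vset (completion V)" using b by (simp add: vset_completion)
  have jb: "(\<lambda>k. C.ndist (j k) (cls b)) \<longlonglongrightarrow> 0"
  proof (rule LIMSEQ_I)
    fix e :: real assume e: "0 < e"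
    then have e2: "0 < e / 2" by simp
    obtain M where M: "\<And>m n. m \<ge> M \<Longrightarrow> n \<ge> M \<Longrightarrow> ndist (b m) (b n) < e / 2"
      using b e2 unfolding cauchy_iff by blast
    have "C.ndist (j k) (cls b) \<le> e / 2" if "k \<ge> M" for k
    proof (rule LIMSEQ_le_const2)
      show "(\<lambda>n. ndist (b k) (b n)) \<longlonglongrightarrow> C.ndist (j k) (cls b)"
        unfolding j_def by (intro ndist_completion const_cauchy bin b)
      show "\<exists>N. \<forall>n\<ge>N. ndist (b k) (b n) \<le> e / 2" using M that less_imp_le by blast
    qed
    then have "norm (C.ndist (j k) (cls b) - 0) < e" if "k \<ge> M" for k
      using that e C.ipnorm_nonneg[OF C.diff_closed[OF jin[of k] Bin]] by fastforce
    then show "\<exists>M. \<forall>k\<ge>M. norm (C.ndist (j k) (cls b) - 0) < e" by blast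
  qed
  have "(\<lambda>k. C.ndist (A k) (cls b)) \<longlonglongrightarrow> 0"
  proof (rule C.null_squeeze[OF LIMSEQ_inverse_real_of_nat jb])
    show "C.ndist (A k) (cls b) \<le> inverse (real (Suc k)) + C.ndist (j k) (cls b)" for k
      using C.ndist_triangle[OF Ain[of k] jin[of k] Bin] Aj[of k] by simp
  qed (use Ain Bin in auto)
  moreover have "\<forall>k. \<exists>n. b k = r k n" unfolding b_def by blast
  ultimately show ?thesis using b by blast
qed

theorem completion_hilbert: "hilbert_carrier (completion V)"
proof -
  interpret C: semi_inner_space "completion V" by (rule completion_semi_inner_space)
  show ?thesis
  proof
    fix A B assume "A \<in> vset (completion V)" "B \<in> vset (completion V)" and d: "C.ndist A B = 0"
    then obtain x y where xy: "x \<in> vset (cauchy_space V)" "A = cls x" "y \<in> vset (cauchy_space V)" "B = cls y"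
      unfolding vset_completion by blast
    show "A = B"
      using ndist_completion[OF xy(1,3)] d unfolding xy(2,4) cls_eq_iff[OF xy(1,3)] by (simp only:)
  next
    fix A assume A: "A \<in> vset (cauchy_space (completion V))"
    have "\<exists>r. r \<in> A k" for k
    proof -
      obtain x where "x \<in> vset (cauchy_space V)" "A k = cls x"
        using C.cauchy_in[OF A, of k] unfolding vset_completion by blast
      then show ?thesis using cauchy.mem_vclass[of x x] by blast
    qed
    then obtain r where "\<And>k. r k \<in> A k" by metis
    from completion_diagonal[OF A this] obtain b
      where "b \<in> vset (cauchy_space V)" "(\<lambda>k. C.ndist (A k) (cls b)) \<longlonglongrightarrow> 0" by blast
    then show "\<exists>B\<in>vset (completion V). (\<lambda>n. C.ndist (A n) B) \<longlonglongrightarrow> 0"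
      unfolding vset_completion by (intro bexI[of _ "cls b"] imageI)
  qed
qed

end


section \<open>Minimizing quadratic functionals\<close>

lemma (in semi_inner_space) limit_imp_cauchy:
  assumes x: "\<And>n. x n \<in> vset V" and a: "a \<in> vset V" and lim: "(\<lambda>n. ndist (x n) a) \<longlonglongrightarrow> 0"
  shows "x \<in> vset (cauchy_space V)"
  unfolding cauchy_iff
proof (intro conjI allI impI x)
  fix e :: real assume "0 < e"
  then have "0 < e / 2" by simp
  then obtain M where "\<forall>n\<ge>M. norm (ndist (x n) a - 0) < e / 2"
    using LIMSEQ_D[OF lim] by blast
  then have M: "ndist (x n) a < e / 2" if "n \<ge> M" for n using that by fastforce
  have "ndist (x m) (x n) < e" if "m \<ge> M" "n \<ge> M" for m n
    using ndist_triangle[OF x[of m] a x[of n]] ndist_commute[OF a x[of n]] M[OF that(1)] M[OF that(2)]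
    by linarith
  then show "\<exists>M. \<forall>m\<ge>M. \<forall>n\<ge>M. ndist (x m) (x n) < e" by blast
qed

lemma (in hilbert_carrier) eq_if_ip_eq:
  assumes a: "a \<in> vset V" and b: "b \<in> vset V" and eq: "\<And>c. c \<in> vset V \<Longrightarrow> ip V a c = ip V b c"
  shows "a = b"
proof (rule definite[OF a b])
  have "ip V (vdiff V a b) (vdiff V a b) = 0"
    using eq[OF diff_closed[OF a b]] ip_diff_left[OF a b diff_closed[OF a b]] by linarith
  then show "ndist a b = 0" by (simp add: ipnorm_def)
qed

lemma (in hilbert_carrier) limit_unique:
  assumes x: "\<And>n. x n \<in> vset V" and a: "a \<in> vset V" and b: "b \<in> vset V"
    and "(\<lambda>n. ndist (x n) a) \<longlonglongrightarrow> 0" "(\<lambda>n. ndist (x n) b) \<longlonglongrightarrow> 0"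
  shows "a = b"
  using assms by (intro eq_if_ip_eq[OF a b] LIMSEQ_unique[OF tendsto_ip tendsto_ip])

text \<open>
  With \<open>l = 0\<close> the functional \<open>F\<close> is the energy whose minimizer in a coset is the extension of a
  trace; with \<open>l\<close> the pullback of a functional on the quotient it is the functional of the
  variational problem.
\<close>

locale quadratic_functional = hilbert_carrier V for V :: "('v, 'r) ipspace_scheme" +
  fixes l :: "'v \<Rightarrow> real" and M :: real
  assumes l_add: "a \<in> vset V \<Longrightarrow> b \<in> vset V \<Longrightarrow> l (vadd V a b) = l a + l b"
    and l_scale: "a \<in> vset V \<Longrightarrow> l (vscale V r a) = r * l a"
    and l_bound: "a \<in> vset V \<Longrightarrow> \<bar>l a\<bar> \<le> M * ipnorm V a"
begin

abbreviation F :: "'v \<Rightarrow> real" where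
  "F u \<equiv> 1 / 2 * (ipnorm V u)\<^sup>2 - l u"

lemma l_diff: "a \<in> vset V \<Longrightarrow> b \<in> vset V \<Longrightarrow> l (vdiff V a b) = l a - l b"
  by (simp add: vdiff_def l_add l_scale)

lemma F_bounded_below:
  assumes "a \<in> vset V"
  shows "- (M\<^sup>2 / 2) \<le> F a"
proof -
  have "0 \<le> (ipnorm V a - M)\<^sup>2" by simp
  then have "- (M\<^sup>2 / 2) \<le> 1 / 2 * (ipnorm V a)\<^sup>2 - M * ipnorm V a"
    unfolding power2_diff by (simp add: algebra_simps)
  then show ?thesis using abs_le_D1[OF l_bound[OF assms]] by linarith
qed

lemma midpoint_identity:
  assumes a: "a \<in> vset V" and b: "b \<in> vset V"
  shows "(ndist a b)\<^sup>2 = 4 * (F a + F b - 2 * F (vscale V (1/2) (vadd V a b)))"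
  using a b ip_sym[OF b a] by (simp add: l_add l_scale algebra_simps)

lemma tendsto_F:
  assumes x: "\<And>n. x n \<in> vset V" and a: "a \<in> vset V" and lim: "(\<lambda>n. ndist (x n) a) \<longlonglongrightarrow> 0"
  shows "(\<lambda>n. F (x n)) \<longlonglongrightarrow> F a"
proof -
  have "(\<lambda>n. M * ndist (x n) a) \<longlonglongrightarrow> M * 0" by (intro tendsto_intros lim)
  then have 0: "(\<lambda>n. M * ndist (x n) a) \<longlonglongrightarrow> 0" by simp
  have "norm (l (x n) - l a) \<le> M * ndist (x n) a" for n
    using l_bound[OF diff_closed[OF x a], of n] by (simp add: l_diff x a)
  then have "(\<lambda>n. l (x n) - l a) \<longlonglongrightarrow> 0"
    by (intro Lim_null_comparison[OF _ 0] always_eventually allI)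
  then have "(\<lambda>n. l (x n)) \<longlonglongrightarrow> l a" by (simp only: LIM_zero_iff)
  then show ?thesis by (intro tendsto_intros tendsto_ipnorm[OF x a lim])
qed

text \<open>
  By the parallelogram identity two points whose values are close to the infimum are close to each
  other. Hence minimizing sequences converge, and minimizers are unique.
\<close>

theorem ex1_minimizer:
  assumes sub: "C \<subseteq> vset V" and ne: "C \<noteq> {}"
    and mid: "\<And>a b. a \<in> C \<Longrightarrow> b \<in> C \<Longrightarrow> vscale V (1/2) (vadd V a b) \<in> C"
    and closed: "\<And>x a. (\<And>n. x n \<in> C) \<Longrightarrow> a \<in> vset V \<Longrightarrow> (\<lambda>n. ndist (x n) a) \<longlonglongrightarrow> 0 \<Longrightarrow> a \<in> C"
  shows "\<exists>!u. is_arg_min F (\<lambda>u. u \<in> C) u"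
proof -
  define m where "m = Inf (F ` C)"
  have bdd: "bdd_below (F ` C)"
    using sub F_bounded_below by (intro bdd_belowI2[where m = "- (M\<^sup>2 / 2)"]) blast
  have m: "m \<le> F u" if "u \<in> C" for u
    unfolding m_def using that by (intro cInf_lower bdd imageI)
  have near: "(ndist a b)\<^sup>2 \<le> 4 * ((F a - m) + (F b - m))" if "a \<in> C" "b \<in> C" for a b
  proof -
    have "a \<in> vset V" "b \<in> vset V" using that sub by blast+
    from midpoint_identity[OF this] show ?thesis using m[OF mid[OF that]] by argo
  qed
  have "\<exists>u\<in>C. F u < m + inverse (real (Suc n))" for n
    using cInf_lessD[of "F ` C" "m + inverse (real (Suc n))"] ne unfolding m_def by auto
  then obtain x where xC: "\<And>n. x n \<in> C" and xm: "\<And>n. F (x n) < m + inverse (real (Suc n))"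
    by metis
  have xV: "x n \<in> vset V" for n using xC sub by blast
  have "x \<in> vset (cauchy_space V)"
    unfolding cauchy_iff
  proof (intro conjI allI impI xV)
    fix e :: real assume e: "0 < e"
    then have "0 < e\<^sup>2 / 8" by simp
    then obtain N where N: "inverse (real (Suc N)) < e\<^sup>2 / 8" using reals_Archimedean by blast
    have small: "F (x n) - m < e\<^sup>2 / 8" if "n \<ge> N" for n
    proof -
      have "inverse (real (Suc n)) \<le> inverse (real (Suc N))"
        using that by (intro le_imp_inverse_le) auto
      then show ?thesis using xm[of n] N by linarith
    qed
    have "(ndist (x p) (x q))\<^sup>2 < e\<^sup>2" if "p \<ge> N" "q \<ge> N" for p q
      using near[OF xC[of p] xC[of q]] small[OF that(1)] small[OF that(2)] by argo
    then have "ndist (x p) (x q) < e" if "p \<ge> N" "q \<ge> N" for p q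
      using that e by (intro power2_less_imp_less[of _ e]) auto
    then show "\<exists>N. \<forall>p\<ge>N. \<forall>q\<ge>N. ndist (x p) (x q) < e" by blast
  qed
  from complete[OF this] obtain u where uV: "u \<in> vset V" and lim: "(\<lambda>n. ndist (x n) u) \<longlonglongrightarrow> 0"
    by blast
  have uC: "u \<in> C" by (rule closed[OF xC uV lim])
  have "F u \<le> m + 0"
  proof (rule LIMSEQ_le[OF tendsto_F[OF xV uV lim]])
    show "(\<lambda>n. m + inverse (real (Suc n))) \<longlonglongrightarrow> m + 0"
      by (intro tendsto_intros LIMSEQ_inverse_real_of_nat)
    show "\<exists>N. \<forall>n\<ge>N. F (x n) \<le> m + inverse (real (Suc n))" using xm less_imp_le by blast
  qed
  then have u: "F u \<le> F v" if "v \<in> C" for v using m[OF that] by linarith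
  show ?thesis
  proof (rule ex1I[of _ u])
    show "is_arg_min F (\<lambda>u. u \<in> C) u"
      unfolding is_arg_min_def using uC u by (meson not_less)
    fix v assume "is_arg_min F (\<lambda>u. u \<in> C) v"
    then have vC: "v \<in> C" and "F v \<le> F u" using uC by (auto simp: is_arg_min_def)
    then have "F v - m \<le> 0" "F u - m \<le> 0" using \<open>F u \<le> m + 0\<close> by linarith+
    then have "(ndist v u)\<^sup>2 \<le> 0" using near[OF vC uC] by argo
    then have "ndist v u = 0" by (simp del: ipnorm_sq)
    then show "v = u" using vC uV sub by (intro definite) auto
  qed
qed

text \<open>
  Along a line through \<open>u\<close> the functional is \<open>F u + t p + t\<^sup>2 q / 2\<close> with \<open>q \<ge> 0\<close>. If \<open>p\<close> were
  nonzero, a small step against its sign would decrease the value.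
\<close>

lemma stationary:
  assumes u: "u \<in> vset V" and d: "d \<in> vset V" and min: "\<And>t. F u \<le> F (vadd V u (vscale V t d))"
  shows "ip V u d = l d"
proof -
  define p where "p = ip V u d - l d"
  define q where "q = ip V d d"
  have q: "0 \<le> q" unfolding q_def using d by simp
  have var: "F (vadd V u (vscale V t d)) = F u + t * p + t\<^sup>2 / 2 * q" for t
    using u d ip_sym[OF d u]
    by (simp add: l_add l_scale p_def q_def algebra_simps) (simp add: power2_eq_square)
  \<comment> \<open>The optimal step would be \<open>- p / q\<close>; enlarging the denominator covers the case \<open>q = 0\<close>.\<close>
  have "0 \<le> - p / (q + 1) * p + (- p / (q + 1))\<^sup>2 / 2 * q"
    using min[of "- p / (q + 1)"] unfolding var by linarith
  also have "\<dots> = - (p\<^sup>2 * (q + 2) / (2 * (q + 1)\<^sup>2))"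
    using q by (simp add: field_simps power2_eq_square add_nonneg_eq_0_iff)
  finally have "p\<^sup>2 * (q + 2) / (2 * (q + 1)\<^sup>2) \<le> 0" by linarith
  then have "p = 0" using q by (auto simp: divide_le_0_iff mult_le_0_iff)
  then show ?thesis by (simp add: p_def)
qed

text \<open>
  Completing the square: \<open>F v - F u\<close> is then half the squared distance of \<open>u\<close> and \<open>v\<close>.
\<close>

lemma minimal_if_stationary:
  assumes u: "u \<in> vset V" and v: "v \<in> vset V" and eq: "ip V u (vdiff V v u) = l (vdiff V v u)"
  shows "F u \<le> F v"
proof -
  have "F v = F u + 1 / 2 * ip V (vdiff V v u) (vdiff V v u)"
    using u v eq ip_sym[OF v u] by (simp add: l_diff algebra_simps)
  then show ?thesis using ip_nonneg[OF diff_closed[OF v u]] by linarith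
qed

end


section \<open>Functionals on the quotient by a closed subspace\<close>

locale hilbert_quotient = hilbert_carrier H for H :: "('v, 'r) ipspace_scheme" +
  fixes K :: "'v set"
  assumes K_sub: "K \<subseteq> vset H" and K_ne: "K \<noteq> {}"
    and K_add: "a \<in> K \<Longrightarrow> b \<in> K \<Longrightarrow> vadd H a b \<in> K"
    and K_scale: "a \<in> K \<Longrightarrow> vscale H r a \<in> K"
    and K_closed: "(\<And>n. x n \<in> K) \<Longrightarrow> a \<in> vset H \<Longrightarrow> (\<lambda>n. ndist (x n) a) \<longlonglongrightarrow> 0 \<Longrightarrow> a \<in> K"
begin

lemma K_in: "k \<in> K \<Longrightarrow> k \<in> vset H"
  using K_sub by blast

lemma diff_self_in_K: assumes "a \<in> vset H" shows "vdiff H a a \<in> K"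
proof -
  obtain k where k: "k \<in> K" using K_ne by blast
  have "vdiff H a a = vscale H 0 k"
    using assms K_in[OF k] by (intro eq_if_ip_eq) auto
  then show ?thesis using K_scale[OF k] by simp
qed

sublocale vspace_congruence H K
proof
  show "equiv (vset H) (vquot_rel H K)"
  proof (rule equivI)
    show "vquot_rel H K \<subseteq> vset H \<times> vset H" by (auto simp: vquot_rel_def)
    show "refl_on (vset H) (vquot_rel H K)"
      by (auto simp: refl_on_def vquot_rel_def diff_self_in_K)
    show "sym (vquot_rel H K)"
    proof (rule symI)
      fix a b assume "(a, b) \<in> vquot_rel H K"
      then have ab: "a \<in> vset H" "b \<in> vset H" "vdiff H a b \<in> K" by (auto simp: vquot_rel_def)
      have "vdiff H b a = vscale H (-1) (vdiff H a b)" using ab by (intro eq_if_ip_eq) auto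
      then show "(b, a) \<in> vquot_rel H K" using ab K_scale by (auto simp: vquot_rel_def)
    qed
    show "trans (vquot_rel H K)"
    proof (rule transI)
      fix a b c assume "(a, b) \<in> vquot_rel H K" "(b, c) \<in> vquot_rel H K"
      then have abc: "a \<in> vset H" "b \<in> vset H" "c \<in> vset H" "vdiff H a b \<in> K" "vdiff H b c \<in> K"
        by (auto simp: vquot_rel_def)
      have "vdiff H a c = vadd H (vdiff H a b) (vdiff H b c)"
        using abc by (intro eq_if_ip_eq) auto
      then show "(a, c) \<in> vquot_rel H K" using abc K_add by (auto simp: vquot_rel_def)
    qed
  qed
  fix a a' b b' assume "(a, a') \<in> vquot_rel H K" "(b, b') \<in> vquot_rel H K"
  then have ab: "a \<in> vset H" "a' \<in> vset H" "b \<in> vset H" "b' \<in> vset H" "vdiff H a a' \<in> K" "vdiff H b b' \<in> K"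
    by (auto simp: vquot_rel_def)
  have "vdiff H (vadd H a b) (vadd H a' b') = vadd H (vdiff H a a') (vdiff H b b')"
    using ab by (intro eq_if_ip_eq) auto
  then show "(vadd H a b, vadd H a' b') \<in> vquot_rel H K"
    using ab K_add by (auto simp: vquot_rel_def)
next
  fix a a' r assume "(a, a') \<in> vquot_rel H K"
  then have a: "a \<in> vset H" "a' \<in> vset H" "vdiff H a a' \<in> K" by (auto simp: vquot_rel_def)
  have "vdiff H (vscale H r a) (vscale H r a') = vscale H r (vdiff H a a')"
    using a by (intro eq_if_ip_eq) (auto simp: algebra_simps)
  then show "(vscale H r a, vscale H r a') \<in> vquot_rel H K"
    using a K_scale by (auto simp: vquot_rel_def)
qed

abbreviation X :: "'v set nspace" where
  "X \<equiv> quotient_nspace H K"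

abbreviation q :: "'v \<Rightarrow> 'v set" where
  "q \<equiv> vclass H K"

lemma vset_X: "vset X = q ` vset H"
  by (simp add: quotient_nspace_def vset_vquot)

lemma vadd_X: "a \<in> vset H \<Longrightarrow> b \<in> vset H \<Longrightarrow> vadd X (q a) (q b) = q (vadd H a b)"
  by (simp add: quotient_nspace_def vadd_vquot)

lemma vscale_X: "a \<in> vset H \<Longrightarrow> vscale X r (q a) = q (vscale H r a)"
  by (simp add: quotient_nspace_def vscale_vquot)

lemma nrm_X_le: "a \<in> vset H \<Longrightarrow> nrm X (q a) \<le> ipnorm H a"
  unfolding quotient_nspace_def
  by (auto simp: mem_vclass intro!: cINF_lower bdd_belowI2[where m = 0])

lemma nrm_X_nonneg: "a \<in> vset H \<Longrightarrow> 0 \<le> nrm X (q a)"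
proof -
  assume a: "a \<in> vset H"
  then have "q a \<noteq> {}" using mem_vclass[OF a, of a] by blast
  then have "0 \<le> (INF b\<in>q a. ipnorm H b)"
    using mem_vclass[OF a] by (intro cINF_greatest) auto
  then show ?thesis by (simp add: quotient_nspace_def)
qed

text \<open>
  On the cylinder, with \<open>K\<close> the completion of the functions compactly supported in the open
  cylinder, this is the extension operator.
\<close>

definition min_rep :: "'v set \<Rightarrow> 'v" where
  "min_rep v = (THE u. is_arg_min (\<lambda>u. 1 / 2 * (ipnorm H u)\<^sup>2) (\<lambda>u. u \<in> vset H \<and> q u = v) u)"

lemma norm_functional: "quadratic_functional H (\<lambda>_. 0) 0"
  by unfold_locales simp_all

lemma ex1_min_rep:
  assumes "v \<in> vset X"
  shows "\<exists>!u. is_arg_min (\<lambda>u. 1 / 2 * (ipnorm H u)\<^sup>2) (\<lambda>u. u \<in> vset H \<and> q u = v) u"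
proof -
  interpret N: quadratic_functional H "\<lambda>_. 0" 0 by (rule norm_functional)
  obtain c where c: "c \<in> vset H" "v = q c" using assms by (auto simp: vset_X)
  define C where "C = {u. u \<in> vset H \<and> q u = v}"
  have C_iff: "u \<in> C \<longleftrightarrow> u \<in> vset H \<and> vdiff H u c \<in> K" for u
    using c(1) vclass_eq_iff unfolding C_def c(2) by blast
  have "\<exists>!u. is_arg_min N.F (\<lambda>u. u \<in> C) u"
  proof (rule N.ex1_minimizer)
    show "C \<subseteq> vset H" by (auto simp: C_def)
    show "C \<noteq> {}" using c by (auto simp: C_def)
  next
    fix a b assume ab: "a \<in> C" "b \<in> C"
    have "vdiff H (vscale H (1/2) (vadd H a b)) c = vscale H (1/2) (vadd H (vdiff H a c) (vdiff H b c))"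
      using ab c(1) by (intro eq_if_ip_eq) (auto simp: C_iff algebra_simps)
    then show "vscale H (1/2) (vadd H a b) \<in> C"
      using ab by (auto simp: C_iff K_add K_scale)
  next
    fix x a assume x: "\<And>n. x n \<in> C" and a: "a \<in> vset H" and lim: "(\<lambda>n. ndist (x n) a) \<longlonglongrightarrow> 0"
    have xH: "x n \<in> vset H" for n using x by (simp add: C_iff)
    have "vdiff H a c \<in> K"
    proof (rule K_closed)
      show "vdiff H (x n) c \<in> K" for n using x by (simp add: C_iff)
      show "(\<lambda>n. ndist (vdiff H (x n) c) (vdiff H a c)) \<longlonglongrightarrow> 0"
      proof (rule null_squeeze[OF lim tendsto_const])
        show "ndist (vdiff H (x n) c) (vdiff H a c) \<le> ndist (x n) a + 0" for n
          using ndist_diff[OF xH[of n] c(1) a c(1)] c(1) by simp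
      qed (use xH a c(1) in auto)
    qed (use a c(1) in auto)
    then show "a \<in> C" using a by (simp add: C_iff)
  qed
  then show ?thesis by (simp add: C_def)
qed

lemma min_rep_is_arg_min:
  assumes "v \<in> vset X"
  shows "is_arg_min (\<lambda>u. 1 / 2 * (ipnorm H u)\<^sup>2) (\<lambda>u. u \<in> vset H \<and> q u = v) (min_rep v)"
  unfolding min_rep_def by (rule theI'[OF ex1_min_rep[OF assms]])

lemma min_rep_in: "v \<in> vset X \<Longrightarrow> min_rep v \<in> vset H"
  and q_min_rep: "v \<in> vset X \<Longrightarrow> q (min_rep v) = v"
  using min_rep_is_arg_min[of v] by (simp_all add: is_arg_min_def)

lemma q_add_K:
  assumes "u \<in> vset H" "k \<in> K"
  shows "q (vadd H u k) = q u"
proof -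
  have "vdiff H (vadd H u k) u = k"
    using assms K_in by (intro eq_if_ip_eq) auto
  then show ?thesis using assms K_in by (simp add: vclass_eq_iff)
qed

text \<open>
  Moving along \<open>K\<close> stays in the class, so the minimality of the norm in the class is stationarity
  of the energy in the directions of \<open>K\<close>. Together with \<open>min_rep_eqI\<close> this identifies the minimal
  representatives with the orthogonal complement of \<open>K\<close>.
\<close>

lemma min_rep_orthogonal:
  assumes v: "v \<in> vset X" and k: "k \<in> K"
  shows "ip H (min_rep v) k = 0"
proof -
  interpret N: quadratic_functional H "\<lambda>_. 0" 0 by (rule norm_functional)
  show ?thesis
  proof (rule N.stationary[OF min_rep_in[OF v] K_in[OF k]])
    fix t
    have "vadd H (min_rep v) (vscale H t k) \<in> vset H"
      using min_rep_in[OF v] K_in[OF k] by blast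
    moreover have "q (vadd H (min_rep v) (vscale H t k)) = v"
      using q_add_K[OF min_rep_in[OF v] K_scale[OF k]] q_min_rep[OF v] by simp
    ultimately have "\<not> 1 / 2 * (ipnorm H (vadd H (min_rep v) (vscale H t k)))\<^sup>2
        < 1 / 2 * (ipnorm H (min_rep v))\<^sup>2"
      using min_rep_is_arg_min[OF v] unfolding is_arg_min_def by blast
    then show "N.F (min_rep v) \<le> N.F (vadd H (min_rep v) (vscale H t k))" by argo
  qed
qed

lemma min_rep_eqI:
  assumes u: "u \<in> vset H" and orth: "\<And>k. k \<in> K \<Longrightarrow> ip H u k = 0"
  shows "min_rep (q u) = u"
proof -
  interpret N: quadratic_functional H "\<lambda>_. 0" 0 by (rule norm_functional)
  have "\<not> 1 / 2 * (ipnorm H v)\<^sup>2 < 1 / 2 * (ipnorm H u)\<^sup>2" if v: "v \<in> vset H" "q v = q u" for v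
  proof -
    have "vdiff H v u \<in> K" using v u vclass_eq_iff by blast
    then have "N.F u \<le> N.F v" by (intro N.minimal_if_stationary u v(1) orth)
    then show ?thesis by argo
  qed
  then have min: "is_arg_min (\<lambda>u. 1 / 2 * (ipnorm H u)\<^sup>2) (\<lambda>v. v \<in> vset H \<and> q v = q u) u"
    unfolding is_arg_min_def using u by blast
  have "q u \<in> vset X" using u unfolding vset_X by blast
  from the1_equality[OF ex1_min_rep[OF this] min] show ?thesis unfolding min_rep_def .
qed

text \<open>
  A vector orthogonal to the subspace acts on classes: its action does not depend on the
  representative, so by the Cauchy-Schwarz inequality it is bounded by the norm of every
  representative and hence by their infimum, the quotient norm.
\<close>

lemma ex1_dual:
  assumes u: "u \<in> vset H" and orth: "\<And>k. k \<in> K \<Longrightarrow> ip H u k = 0"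
  shows "\<exists>!f. f \<in> dual X \<and> (\<forall>\<psi>\<in>vset H. f (q \<psi>) = ip H u \<psi>)"
proof -
  have inv: "ip H u a = ip H u b" if "a \<in> vset H" "b \<in> vset H" "q a = q b" for a b
    using orth[of "vdiff H a b"] that u by (auto simp: vclass_eq_iff)
  define f where "f = restrict (\<lambda>A. ip H u (SOME a. a \<in> vset H \<and> q a = A)) (vset X)"
  have f: "f (q \<psi>) = ip H u \<psi>" if "\<psi> \<in> vset H" for \<psi>
  proof -
    let ?a = "SOME a. a \<in> vset H \<and> q a = q \<psi>"
    have a: "?a \<in> vset H \<and> q ?a = q \<psi>"
      using that by (intro someI[where P = "\<lambda>a. a \<in> vset H \<and> q a = q \<psi>"]) blast
    have "f (q \<psi>) = ip H u ?a" using that unfolding f_def vset_X by (intro restrict_apply') blast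
    also have "\<dots> = ip H u \<psi>" using a that by (intro inv) blast+
    finally show ?thesis .
  qed
  have bound: "\<bar>f (q \<psi>)\<bar> \<le> ipnorm H u * nrm X (q \<psi>)" if \<psi>: "\<psi> \<in> vset H" for \<psi>
  proof (cases "ipnorm H u = 0")
    case True
    then show ?thesis using Cauchy_Schwarz[OF u \<psi>] f[OF \<psi>] by simp
  next
    case False
    then have p: "0 < ipnorm H u" using ipnorm_nonneg[OF u] by linarith
    have "q \<psi> \<noteq> {}" using mem_vclass[OF \<psi>, of \<psi>] \<psi> by blast
    then have "\<bar>ip H u \<psi>\<bar> / ipnorm H u \<le> (INF b\<in>q \<psi>. ipnorm H b)"
    proof (rule cINF_greatest)
      fix b assume "b \<in> q \<psi>"
      then have b: "b \<in> vset H" "q b = q \<psi>" using mem_vclass[OF \<psi>] by blast+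
      have "\<bar>ip H u \<psi>\<bar> \<le> ipnorm H u * ipnorm H b"
        using Cauchy_Schwarz[OF u b(1)] inv[OF b(1) \<psi> b(2)] by simp
      then show "\<bar>ip H u \<psi>\<bar> / ipnorm H u \<le> ipnorm H b" using p by (simp add: field_simps)
    qed
    then show ?thesis using p f[OF \<psi>] by (simp add: quotient_nspace_def field_simps)
  qed
  have "f \<in> dual X"
    unfolding dual_def
  proof (intro CollectI conjI)
    show "f \<in> extensional (vset X)" by (simp add: f_def)
    show "\<forall>A\<in>vset X. \<forall>B\<in>vset X. f (vadd X A B) = f A + f B"
      using u by (auto simp: vset_X vadd_X f)
    show "\<forall>c. \<forall>A\<in>vset X. f (vscale X c A) = c * f A"
      using u by (auto simp: vset_X vscale_X f)
    show "\<exists>M. \<forall>A\<in>vset X. \<bar>f A\<bar> \<le> M * nrm X A"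
      using bound by (auto simp: vset_X)
  qed
  moreover have "g = f" if "g \<in> dual X" "\<forall>\<psi>\<in>vset H. g (q \<psi>) = ip H u \<psi>" for g
    using that f \<open>f \<in> dual X\<close>
    by (intro extensionalityI[of g "vset X" f]) (auto simp: dual_def vset_X)
  ultimately show ?thesis using f by blast
qed

text \<open>
  Under the identification of the quotient with the orthogonal complement of \<open>K\<close>, this is the Riesz
  map of the quotient; on the cylinder it is the fractional Laplacian.
\<close>

definition riesz_op :: "'v set \<Rightarrow> ('v set \<Rightarrow> real)" where
  "riesz_op v = (THE f. f \<in> dual X \<and> (\<forall>\<psi>\<in>vset H. f (q \<psi>) = ip H (min_rep v) \<psi>))"

lemma riesz_op_eq_iff:
  assumes v: "v \<in> vset X" and h: "h \<in> dual X"
  shows "riesz_op v = h \<longleftrightarrow> (\<forall>\<psi>\<in>vset H. h (q \<psi>) = ip H (min_rep v) \<psi>)"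
proof -
  note ex1 = ex1_dual[OF min_rep_in[OF v] min_rep_orthogonal[OF v]]
  show ?thesis
  proof
    assume "riesz_op v = h"
    then show "\<forall>\<psi>\<in>vset H. h (q \<psi>) = ip H (min_rep v) \<psi>"
      using theI'[OF ex1] unfolding riesz_op_def by blast
  next
    assume "\<forall>\<psi>\<in>vset H. h (q \<psi>) = ip H (min_rep v) \<psi>"
    then show "riesz_op v = h"
      unfolding riesz_op_def by (intro the1_equality[OF ex1] conjI h)
  qed
qed

lemma pullback_functional:
  assumes h: "h \<in> dual X"
  obtains M where "quadratic_functional H (\<lambda>u. h (q u)) M"
proof -
  obtain M where M: "\<And>A. A \<in> vset X \<Longrightarrow> \<bar>h A\<bar> \<le> M * nrm X A"
    using h unfolding dual_def by blast
  have "quadratic_functional H (\<lambda>u. h (q u)) \<bar>M\<bar>"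
  proof
    fix a b assume ab: "a \<in> vset H" "b \<in> vset H"
    then have "q a \<in> vset X" "q b \<in> vset X" unfolding vset_X by blast+
    then have "h (vadd X (q a) (q b)) = h (q a) + h (q b)" using h unfolding dual_def by blast
    then show "h (q (vadd H a b)) = h (q a) + h (q b)" unfolding vadd_X[OF ab] .
  next
    fix a r assume a: "a \<in> vset H"
    then have "q a \<in> vset X" unfolding vset_X by blast
    then have "h (vscale X r (q a)) = r * h (q a)" using h unfolding dual_def by blast
    then show "h (q (vscale H r a)) = r * h (q a)" unfolding vscale_X[OF a] .
    have "\<bar>h (q a)\<bar> \<le> M * nrm X (q a)" using M a by (simp add: vset_X)
    also have "\<dots> \<le> \<bar>M\<bar> * nrm X (q a)"
      using nrm_X_nonneg[OF a] by (intro mult_right_mono) auto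
    also have "\<dots> \<le> \<bar>M\<bar> * ipnorm H a"
      using nrm_X_le[OF a] by (intro mult_left_mono) auto
    finally show "\<bar>h (q a)\<bar> \<le> \<bar>M\<bar> * ipnorm H a" .
  qed
  then show thesis by (rule that)
qed

text \<open>
  A minimizer \<open>u\<close> of \<open>J\<close> represents \<open>h \<circ> q\<close>. This functional vanishes on \<open>K\<close>, so \<open>u\<close> is
  orthogonal to \<open>K\<close> and is the minimal representative of its own class; hence \<open>q u\<close> is a solution.
  Any solution has a minimal representative that represents the same functional, hence equal
  to \<open>u\<close>.
\<close>

theorem riesz_op_solution:
  assumes h: "h \<in> dual X"
  defines "J \<equiv> \<lambda>u. 1 / 2 * (ipnorm H u)\<^sup>2 - h (q u)"
  shows "\<exists>!v. v \<in> vset X \<and> riesz_op v = h"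
    and "\<exists>u. is_arg_min J (\<lambda>u. u \<in> vset H) u"
    and "is_arg_min J (\<lambda>u. u \<in> vset H) u \<Longrightarrow> q u \<in> vset X \<and> riesz_op (q u) = h"
proof -
  obtain M where "quadratic_functional H (\<lambda>u. h (q u)) M" using pullback_functional[OF h] .
  then interpret Q: quadratic_functional H "\<lambda>u. h (q u)" M .
  show ex: "\<exists>u. is_arg_min J (\<lambda>u. u \<in> vset H) u"
    unfolding J_def
    by (rule ex1_implies_ex[OF Q.ex1_minimizer]) (intro subset_refl nonempty scale_closed add_closed | assumption)+
  have rep: "ip H u \<psi> = h (q \<psi>)" if u: "is_arg_min J (\<lambda>u. u \<in> vset H) u" and \<psi>: "\<psi> \<in> vset H" for u \<psi>
  proof (rule Q.stationary)
    show uH: "u \<in> vset H" using u unfolding is_arg_min_def by blast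
    show "Q.F u \<le> Q.F (vadd H u (vscale H t \<psi>))" for t
    proof -
      have "vadd H u (vscale H t \<psi>) \<in> vset H" by (intro add_closed scale_closed uH \<psi>)
      then have "\<not> J (vadd H u (vscale H t \<psi>)) < J u" using u unfolding is_arg_min_def by blast
      then show ?thesis unfolding J_def by (simp only: not_less)
    qed
  qed (rule \<psi>)
  have h0: "h (q k) = 0" if k: "k \<in> K" for k
  proof -
    have kH: "k \<in> vset H" by (rule K_in[OF k])
    show ?thesis using Q.l_add[OF kH kH] unfolding q_add_K[OF kH k] by simp
  qed
  have sol: "q u \<in> vset X \<and> min_rep (q u) = u \<and> riesz_op (q u) = h"
    if u: "is_arg_min J (\<lambda>u. u \<in> vset H) u" for u
  proof -
    have uH: "u \<in> vset H" using u unfolding is_arg_min_def by blast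
    have min: "min_rep (q u) = u"
    proof (rule min_rep_eqI[OF uH])
      show "ip H u k = 0" if "k \<in> K" for k using rep[OF u K_in[OF that]] h0[OF that] by simp
    qed
    have qu: "q u \<in> vset X" using uH unfolding vset_X by blast
    have "riesz_op (q u) = h" unfolding riesz_op_eq_iff[OF qu h] min using rep[OF u] by simp
    then show ?thesis using min qu by blast
  qed
  then show "is_arg_min J (\<lambda>u. u \<in> vset H) u \<Longrightarrow> q u \<in> vset X \<and> riesz_op (q u) = h" by blast
  obtain u where u: "is_arg_min J (\<lambda>u. u \<in> vset H) u" using ex by blast
  show "\<exists>!v. v \<in> vset X \<and> riesz_op v = h"
  proof (rule ex1I[of _ "q u"])
    show "q u \<in> vset X \<and> riesz_op (q u) = h" using sol[OF u] by blast
    fix v assume "v \<in> vset X \<and> riesz_op v = h"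
    then have v: "v \<in> vset X" and "\<forall>\<psi>\<in>vset H. h (q \<psi>) = ip H (min_rep v) \<psi>"
      using riesz_op_eq_iff[OF _ h] by blast+
    moreover have "u \<in> vset H" using u unfolding is_arg_min_def by blast
    ultimately have "min_rep v = u"
      using rep[OF u] by (intro eq_if_ip_eq min_rep_in[OF v]) simp_all
    then show "v = q u" using q_min_rep[OF v] by simp
  qed
qed

end

text \<open>
  The set \<open>W\<close> enters only through its part inside the carrier, because representatives of
  elements of the completion are sequences in the carrier. Closedness of the completed subspace is
  the diagonal argument applied to representatives with values in \<open>W\<close>.
\<close>

lemma (in semi_inner_space) completion_sub_quotient:
  assumes ne: "W \<inter> vset V \<noteq> {}"
    and add: "\<And>a b. a \<in> W \<inter> vset V \<Longrightarrow> b \<in> W \<inter> vset V \<Longrightarrow> vadd V a b \<in> W"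
    and scale: "\<And>a r. a \<in> W \<inter> vset V \<Longrightarrow> vscale V r a \<in> W"
  shows "hilbert_quotient (completion V) (completion_sub V W)"
proof -
  interpret C: hilbert_carrier "completion V" by (rule completion_hilbert)
  have mem: "A \<in> completion_sub V W \<longleftrightarrow> (\<exists>a\<in>vset (cauchy_space V). range a \<subseteq> W \<and> A = cls a)" for A
  proof
    assume "A \<in> completion_sub V W"
    then obtain x a where "x \<in> vset (cauchy_space V)" "A = cls x" "a \<in> A" "range a \<subseteq> W"
      unfolding completion_sub_def vset_completion by blast
    then show "\<exists>a\<in>vset (cauchy_space V). range a \<subseteq> W \<and> A = cls a"
      using cauchy.mem_vclass[of x a] by blast
  next
    assume "\<exists>a\<in>vset (cauchy_space V). range a \<subseteq> W \<and> A = cls a"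
    then show "A \<in> completion_sub V W"
      unfolding completion_sub_def vset_completion using cauchy.mem_vclass by blast
  qed
  show ?thesis
  proof
    show "completion_sub V W \<subseteq> vset (completion V)" by (auto simp: completion_sub_def)
    obtain a where "a \<in> W" "a \<in> vset V" using ne by blast
    then have "(\<lambda>_. a) \<in> vset (cauchy_space V)" "range (\<lambda>_::nat. a) \<subseteq> W"
      using const_cauchy[of a] by auto
    then have "cls (\<lambda>_. a) \<in> completion_sub V W" unfolding mem by blast
    then show "completion_sub V W \<noteq> {}" by blast
  next
    fix A B assume "A \<in> completion_sub V W" "B \<in> completion_sub V W"
    then obtain a b where ab: "a \<in> vset (cauchy_space V)" "range a \<subseteq> W" "A = cls a"
      "b \<in> vset (cauchy_space V)" "range b \<subseteq> W" "B = cls b"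
      unfolding mem by blast
    have "range (vadd (cauchy_space V) a b) \<subseteq> W"
      using ab(2,5) cauchy_in[OF ab(1)] cauchy_in[OF ab(4)] by (auto intro!: add)
    then show "vadd (completion V) A B \<in> completion_sub V W"
      unfolding mem ab(3,6) vadd_completion[OF ab(1,4)] using cauchy_add_closed[OF ab(1,4)] by blast
  next
    fix A r assume "A \<in> completion_sub V W"
    then obtain a where a: "a \<in> vset (cauchy_space V)" "range a \<subseteq> W" "A = cls a"
      unfolding mem by blast
    have "range (vscale (cauchy_space V) r a) \<subseteq> W"
      using a(2) cauchy_in[OF a(1)] by (auto intro!: scale)
    then show "vscale (completion V) r A \<in> completion_sub V W"
      unfolding mem a(3) vscale_completion[OF a(1)] using cauchy_scale_closed[OF a(1)] by blast
  next
    fix x A assume x: "\<And>n. x n \<in> completion_sub V W" and A: "A \<in> vset (completion V)"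
      and lim: "(\<lambda>n. C.ndist (x n) A) \<longlonglongrightarrow> 0"
    have xC: "x n \<in> vset (completion V)" for n using x by (simp add: completion_sub_def)
    have "\<exists>a. a \<in> x n \<and> range a \<subseteq> W" for n using x[of n] by (auto simp: completion_sub_def)
    then obtain r where r: "\<And>n. r n \<in> x n" "\<And>n. range (r n) \<subseteq> W" by metis
    obtain b where b: "b \<in> vset (cauchy_space V)" "\<forall>k. \<exists>n. b k = r k n"
      and blim: "(\<lambda>k. C.ndist (x k) (cls b)) \<longlonglongrightarrow> 0"
      using completion_diagonal[OF C.limit_imp_cauchy[OF xC A lim] r(1)] by blast
    have "cls b \<in> vset (completion V)" unfolding vset_completion using b(1) by blast
    then have "A = cls b" using C.limit_unique[OF xC A _ lim blim] by blast
    moreover have "range b \<subseteq> W"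
    proof
      fix y assume "y \<in> range b"
      then obtain k where "y = b k" by blast
      then show "y \<in> W" using b(2) r(2)[of k] by (metis rangeI subsetD)
    qed
    ultimately show "A \<in> completion_sub V W" unfolding mem using b(1) by blast
  qed
qed


section \<open>Linear combinations of smooth functions\<close>

lemma C_infty_has_derivative:
  assumes "open U" "C_infty U u" "bs \<in> lists Basis" "X \<in> U"
  shows "(ideriv bs u has_derivative frechet_derivative (ideriv bs u) (at X)) (at X)"
proof -
  have "ideriv bs u differentiable at X within U"
    using assms unfolding C_infty_def differentiable_on_def by blast
  then show ?thesis
    unfolding at_within_open[OF assms(4,1)] frechet_derivative_works .
qed

lemma ideriv_lincomb_has_derivative:
  assumes U: "open U" and u: "C_infty U u" and v: "C_infty U v" and bs: "bs \<in> lists Basis"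
    and X: "X \<in> U"
    and eq: "\<And>Y. Y \<in> U \<Longrightarrow> ideriv bs (\<lambda>X. a * u X + b * v X) Y = a * ideriv bs u Y + b * ideriv bs v Y"
  shows "(ideriv bs (\<lambda>X. a * u X + b * v X) has_derivative
    (\<lambda>h. a * frechet_derivative (ideriv bs u) (at X) h + b * frechet_derivative (ideriv bs v) (at X) h)) (at X)"
proof (rule has_derivative_transform_within_open[OF _ U X])
  show "((\<lambda>Y. a * ideriv bs u Y + b * ideriv bs v Y) has_derivative
    (\<lambda>h. a * frechet_derivative (ideriv bs u) (at X) h + b * frechet_derivative (ideriv bs v) (at X) h)) (at X)"
    by (rule has_derivative_add[OF
          has_derivative_mult_right[OF C_infty_has_derivative[OF U u bs X]]
          has_derivative_mult_right[OF C_infty_has_derivative[OF U v bs X]]])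
  show "a * ideriv bs u Y + b * ideriv bs v Y = ideriv bs (\<lambda>X. a * u X + b * v X) Y" if "Y \<in> U" for Y
    using eq[OF that] by (rule sym)
qed

text \<open>
  The iterated derivatives agree only on \<open>U\<close>, but a derivative at a point of an open set depends on
  the values in that set only, so linearity passes to the next order.
\<close>

lemma ideriv_lincomb:
  assumes U: "open U" and u: "C_infty U u" and v: "C_infty U v"
  shows "bs \<in> lists Basis \<Longrightarrow> X \<in> U \<Longrightarrow>
    ideriv bs (\<lambda>X. a * u X + b * v X) X = a * ideriv bs u X + b * ideriv bs v X"
proof (induction bs arbitrary: X)
  case (Cons c bs)
  then have bs: "bs \<in> lists Basis" by simp
  from frechet_derivative_at[OF ideriv_lincomb_has_derivative[OF U u v bs Cons.prems(2) Cons.IH[OF bs]], symmetric]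
  show ?case by simp
qed simp

lemma C_infty_lincomb:
  assumes "open U" "C_infty U u" "C_infty U v"
  shows "C_infty U (\<lambda>X. a * u X + b * v X)"
  unfolding C_infty_def
proof (intro ballI differentiable_at_imp_differentiable_on)
  fix bs :: "'a list" and X assume "bs \<in> lists Basis" "X \<in> U"
  with ideriv_lincomb_has_derivative[OF assms this ideriv_lincomb[OF assms this(1)]]
  show "ideriv bs (\<lambda>X. a * u X + b * v X) differentiable at X"
    unfolding differentiable_def by blast
qed

lemma C_infty_closure_lincomb:
  assumes U: "open U" and u: "C_infty_closure U u" and v: "C_infty_closure U v"
  shows "C_infty_closure U (\<lambda>X. a * u X + b * v X)"
  unfolding C_infty_closure_def
proof (intro conjI ballI)
  have s: "C_infty U u" "C_infty U v" using u v by (simp_all add: C_infty_closure_def)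
  then show "C_infty U (\<lambda>X. a * u X + b * v X)" by (intro C_infty_lincomb U)
  show "continuous_on (closure U) (\<lambda>X. a * u X + b * v X)"
    using u v by (intro continuous_intros) (simp_all add: C_infty_closure_def)
  fix bs :: "'a list" assume bs: "bs \<in> lists Basis"
  obtain f where f: "continuous_on (closure U) f" "\<forall>X\<in>U. f X = ideriv bs u X"
    using u bs unfolding C_infty_closure_def by blast
  obtain g where g: "continuous_on (closure U) g" "\<forall>X\<in>U. g X = ideriv bs v X"
    using v bs unfolding C_infty_closure_def by blast
  show "\<exists>g. continuous_on (closure U) g \<and> (\<forall>X\<in>U. g X = ideriv bs (\<lambda>X. a * u X + b * v X) X)"
  proof (intro exI[of _ "\<lambda>X. a * f X + b * g X"] conjI ballI)
    show "continuous_on (closure U) (\<lambda>X. a * f X + b * g X)"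
      using f(1) g(1) by (intro continuous_intros)
    show "a * f X + b * g X = ideriv bs (\<lambda>X. a * u X + b * v X) X" if "X \<in> U" for X
      using ideriv_lincomb[OF U s bs that] f(2) g(2) that by simp
  qed
qed

lemma grad_lincomb:
  assumes U: "open U" and u: "C_infty U u" and v: "C_infty U v" and X: "X \<in> U"
  shows "grad (\<lambda>X. a * u X + b * v X) X = a *\<^sub>R grad u X + b *\<^sub>R grad v X"
proof -
  have nil: "[] \<in> lists Basis" by simp
  have "frechet_derivative (\<lambda>X. a * u X + b * v X) (at X) =
      (\<lambda>h. a * frechet_derivative u (at X) h + b * frechet_derivative v (at X) h)"
    using frechet_derivative_at[OF ideriv_lincomb_has_derivative[OF U u v nil X]] by simp
  then show ?thesis
    by (simp add: grad_def scaleR_sum_right scaleR_add_left sum.distrib)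
qed

lemma supp_lincomb: "supp (\<lambda>X. a * u X + b * v X) \<subseteq> supp u \<union> supp v"
  unfolding supp_def closure_Un[symmetric] by (intro closure_mono) auto

lemma compact_supp_lincomb:
  assumes "compact (supp u)" "compact (supp v)"
  shows "compact (supp (\<lambda>X. a * u X + b * v X))"
  using compact_Int_closed[OF compact_Un[OF assms], of "supp (\<lambda>X. a * u X + b * v X)"]
    supp_lincomb[of a u b v]
  by (simp add: supp_def Int_absorb1)

lemma ideriv_zero: "ideriv bs (\<lambda>_. 0) = (\<lambda>_. 0)"
  by (induction bs) simp_all

lemma C_infty_zero: "C_infty U (\<lambda>_. 0)"
  unfolding C_infty_def by (simp add: ideriv_zero)

lemma C_infty_closure_zero: "C_infty_closure U (\<lambda>_. 0)"
  unfolding C_infty_closure_def by (auto simp: C_infty_zero ideriv_zero intro!: exI[of _ "\<lambda>_. 0"])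

lemma supp_zero: "supp (\<lambda>_. 0) = {}"
  by (simp add: supp_def)

lemma grad_zero: "grad (\<lambda>_. 0) = (\<lambda>_. 0)"
  by (simp add: grad_def fun_eq_iff)


section \<open>Weighted spaces of square-integrable functions\<close>

locale weighted_domain =
  fixes U :: "'a::euclidean_space set" and w :: "'a \<Rightarrow> real"
  assumes open_U: "open U"
    and w_measurable: "set_borel_measurable lebesgue U w"
    and w_nonneg: "AE X in lebesgue. X \<in> U \<longrightarrow> 0 \<le> w X"
begin

lemma U_lebesgue: "U \<in> sets lebesgue"
  using open_U by (simp add: borel_open)

lemma weighted_inner_measurable:
  fixes f g :: "'a \<Rightarrow> 'b::euclidean_space"
  assumes "set_borel_measurable lebesgue U f" "set_borel_measurable lebesgue U g"
  shows "set_borel_measurable lebesgue U (\<lambda>X. w X * (f X \<bullet> g X))"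
proof -
  have "(\<lambda>X. (indicator U X *\<^sub>R w X) * ((indicator U X *\<^sub>R f X) \<bullet> (indicator U X *\<^sub>R g X))) \<in> borel_measurable lebesgue"
    using assms w_measurable unfolding set_borel_measurable_def
    by (intro borel_measurable_times borel_measurable_inner)
  also have "(\<lambda>X. (indicator U X *\<^sub>R w X) * ((indicator U X *\<^sub>R f X) \<bullet> (indicator U X *\<^sub>R g X))) =
      (\<lambda>X. indicator U X *\<^sub>R (w X * (f X \<bullet> g X)))"
    by (auto simp: indicator_def fun_eq_iff)
  finally show ?thesis unfolding set_borel_measurable_def .
qed

text \<open>
  The weight may be negative on a null set, where the two integrands differ: one is truncated
  at \<open>0\<close>, the other is replaced by its absolute value.
\<close>

lemma L2_weighted_iff:
  fixes f :: "'a \<Rightarrow> 'b::euclidean_space"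
  shows "f \<in> L2_weighted U w \<longleftrightarrow>
    set_borel_measurable lebesgue U f \<and> set_integrable lebesgue U (\<lambda>X. w X * (f X \<bullet> f X))"
proof -
  have "(\<integral>\<^sup>+X\<in>U. ennreal ((norm (f X))\<^sup>2 * w X) \<partial>lebesgue) =
      (\<integral>\<^sup>+X. ennreal (norm (indicator U X *\<^sub>R (w X * (f X \<bullet> f X)))) \<partial>lebesgue)"
    using w_nonneg
    by (intro nn_integral_cong_AE) (auto simp: indicator_def dot_square_norm mult.commute abs_mult elim!: eventually_mono)
  then show ?thesis
    using weighted_inner_measurable[of f f]
    unfolding L2_weighted_def set_integrable_def integrable_iff_bounded set_borel_measurable_def
    by auto
qed

lemma weighted_inner_integrable:
  fixes f g :: "'a \<Rightarrow> 'b::euclidean_space"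
  assumes f: "f \<in> L2_weighted U w" and g: "g \<in> L2_weighted U w"
  shows "set_integrable lebesgue U (\<lambda>X. w X * (f X \<bullet> g X))"
proof (rule set_integrable_bound)
  show "set_integrable lebesgue U (\<lambda>X. w X * (f X \<bullet> f X) + w X * (g X \<bullet> g X))"
    using f g by (intro set_integral_add) (simp_all add: L2_weighted_iff)
  show "set_borel_measurable lebesgue U (\<lambda>X. w X * (f X \<bullet> g X))"
    using f g by (intro weighted_inner_measurable) (simp_all add: L2_weighted_iff)
  have "\<bar>x \<bullet> y\<bar> \<le> x \<bullet> x + y \<bullet> y" for x y :: 'b
  proof -
    have "\<bar>x \<bullet> y\<bar> \<le> norm x * norm y" by (rule Cauchy_Schwarz_ineq2)
    also have "\<dots> \<le> (norm x)\<^sup>2 + (norm y)\<^sup>2"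
      using sum_squares_bound[of "norm x" "norm y"] mult_nonneg_nonneg[OF norm_ge_zero[of x] norm_ge_zero[of y]]
      by linarith
    finally show ?thesis by (simp add: dot_square_norm)
  qed
  then have *: "0 \<le> c \<Longrightarrow> norm (c * (x \<bullet> y)) \<le> norm (c * (x \<bullet> x) + c * (y \<bullet> y))" for c and x y :: 'b
    using mult_left_mono[of "\<bar>x \<bullet> y\<bar>" "x \<bullet> x + y \<bullet> y" c] by (simp add: abs_mult distrib_left)
  show "AE X in lebesgue. X \<in> U \<longrightarrow>
      norm (w X * (f X \<bullet> g X)) \<le> norm (w X * (f X \<bullet> f X) + w X * (g X \<bullet> g X))"
    using w_nonneg by eventually_elim (use * in blast)
qed

lemma L2_weighted_lincomb:
  fixes f g :: "'a \<Rightarrow> 'b::euclidean_space"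
  assumes f: "f \<in> L2_weighted U w" and g: "g \<in> L2_weighted U w"
    and h: "\<And>X. X \<in> U \<Longrightarrow> h X = a *\<^sub>R f X + b *\<^sub>R g X"
  shows "h \<in> L2_weighted U w"
  unfolding L2_weighted_iff
proof
  have "(\<lambda>X. a *\<^sub>R (indicator U X *\<^sub>R f X) + b *\<^sub>R (indicator U X *\<^sub>R g X)) \<in> borel_measurable lebesgue"
    using f g unfolding L2_weighted_iff set_borel_measurable_def
    by (intro borel_measurable_add borel_measurable_const_scaleR) blast+
  also have "(\<lambda>X. a *\<^sub>R (indicator U X *\<^sub>R f X) + b *\<^sub>R (indicator U X *\<^sub>R g X)) = (\<lambda>X. indicator U X *\<^sub>R h X)"
    by (auto simp: indicator_def h)
  finally show "set_borel_measurable lebesgue U h" unfolding set_borel_measurable_def .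
  have "set_integrable lebesgue U (\<lambda>X. (a * a) * (w X * (f X \<bullet> f X)) + (2 * a * b) * (w X * (f X \<bullet> g X))
      + (b * b) * (w X * (g X \<bullet> g X)))"
    by (intro set_integral_add set_integrable_mult_right weighted_inner_integrable f g)
  also have "?this \<longleftrightarrow> set_integrable lebesgue U (\<lambda>X. w X * (h X \<bullet> h X))"
    by (intro set_integrable_cong) (simp_all add: h inner_add_left inner_add_right inner_commute algebra_simps)
  finally show "set_integrable lebesgue U (\<lambda>X. w X * (h X \<bullet> h X))" .
qed

lemma L2_weighted_zero: "(\<lambda>_. 0) \<in> L2_weighted U w"
  unfolding L2_weighted_iff by (simp add: set_borel_measurable_def set_integrable_def)

end


section \<open>The weight on the cylinder\<close>

lemma null_sets_lborel_fst:
  assumes "N \<in> null_sets (lborel :: 'a::euclidean_space measure)"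
  shows "fst -` N \<in> null_sets (lborel :: ('a \<times> 'b::euclidean_space) measure)"
proof -
  have N: "N \<in> sets lborel" "emeasure lborel N = 0" using assms by auto
  have "emeasure (lborel \<Otimes>\<^sub>M lborel) (N \<times> (UNIV :: 'b set)) = 0"
    using N by (subst lborel.emeasure_pair_measure_Times) auto
  moreover have "N \<times> (UNIV :: 'b set) \<in> sets (lborel \<Otimes>\<^sub>M lborel)"
    using N by (intro pair_measureI) auto
  moreover have "fst -` N = N \<times> (UNIV :: 'b set)" by auto
  ultimately show ?thesis unfolding lborel_prod by auto
qed

text \<open>
  Coefficients that are merely Lebesgue measurable in \<open>x\<close> remain so as functions of \<open>(x, y)\<close>,
  because the cylinder over a null set is a null set.
\<close>

lemma fst_lebesgue_measurable:
  "fst \<in> (lebesgue :: ('a::euclidean_space \<times> 'b::euclidean_space) measure) \<rightarrow>\<^sub>M lebesgue"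
proof (rule completion.measurable_completion2)
  show fst: "fst \<in> (lebesgue :: ('a \<times> 'b) measure) \<rightarrow>\<^sub>M lborel"
    by (intro measurable_completion) (simp add: borel_measurable_continuous_onI continuous_on_fst)
  show "null_sets lborel \<subseteq> null_sets (distr (lebesgue :: ('a \<times> 'b) measure) lborel fst)"
  proof
    fix N :: "'a set" assume N: "N \<in> null_sets lborel"
    have "fst -` N \<in> null_sets (lebesgue :: ('a \<times> 'b) measure)"
      by (intro null_sets_completionI null_sets_lborel_fst N)
    then show "N \<in> null_sets (distr (lebesgue :: ('a \<times> 'b) measure) lborel fst)"
      using N by (subst null_sets_distr_iff[OF fst]) auto
  qed
qed

lemma cylinder_weighted_domain:
  assumes \<Omega>: "open \<Omega>" and adm: "admissible \<Omega> s G"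
  shows "weighted_domain (cyl \<Omega>) (cyl_weight s G)"
proof
  show op: "open (cyl \<Omega>)" unfolding cyl_def by (intro open_Times \<Omega>) simp
  have \<Omega>s: "\<Omega> \<inter> space lebesgue \<in> sets lebesgue" using \<Omega> by (simp add: borel_open)
  define s' where "s' = (\<lambda>x. indicator \<Omega> x *\<^sub>R s x)"
  define G' where "G' = (\<lambda>x. indicator \<Omega> x *\<^sub>R G x)"
  have sG: "s' \<in> borel_measurable lebesgue" "G' \<in> borel_measurable lebesgue"
    using adm unfolding admissible_def s'_def G'_def borel_measurable_restrict_space_iff[OF \<Omega>s] by blast+
  have sfst: "(\<lambda>X. s' (fst X)) \<in> borel_measurable (lebesgue :: ('a \<times> real) measure)"
    and Gfst: "(\<lambda>X. G' (fst X)) \<in> borel_measurable (lebesgue :: ('a \<times> real) measure)"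
    by (rule measurable_compose[OF fst_lebesgue_measurable] sG)+
  have snd: "snd \<in> borel_measurable (lebesgue :: ('a \<times> real) measure)"
    by (intro measurable_completion) (simp add: borel_measurable_continuous_onI continuous_on_snd)
  have ind: "(indicator (cyl \<Omega>) :: 'a \<times> real \<Rightarrow> real) \<in> borel_measurable lebesgue"
    using op by (intro borel_measurable_indicator) (simp add: borel_open)
  have "(\<lambda>X. indicator (cyl \<Omega>) X *\<^sub>R (G' (fst X) * snd X powr (1 - 2 * s' (fst X))))
      \<in> borel_measurable lebesgue"
    using sfst Gfst snd ind
    by (intro borel_measurable_scaleR borel_measurable_times powr_real_measurable
        borel_measurable_diff borel_measurable_const)
  also have "(\<lambda>X. indicator (cyl \<Omega>) X *\<^sub>R (G' (fst X) * snd X powr (1 - 2 * s' (fst X)))) =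
      (\<lambda>X. indicator (cyl \<Omega>) X *\<^sub>R cyl_weight s G X)"
    by (auto simp: fun_eq_iff indicator_def cyl_def cyl_weight_def G'_def s'_def)
  finally show "set_borel_measurable lebesgue (cyl \<Omega>) (cyl_weight s G)"
    unfolding set_borel_measurable_def .
  have "AE x in lebesgue_on \<Omega>. 0 < G x" using adm by (simp add: admissible_def)
  then have "AE x in lborel. x \<in> \<Omega> \<longrightarrow> 0 < G x"
    unfolding AE_restrict_space_iff[OF \<Omega>s] AE_completion_iff by simp
  then obtain N where N: "N \<in> null_sets lborel" "{x. \<not> (x \<in> \<Omega> \<longrightarrow> 0 < G x)} \<subseteq> N"
    by (auto elim!: AE_E simp: null_sets_def)
  have "AE X in (lborel :: ('a \<times> real) measure). X \<in> cyl \<Omega> \<longrightarrow> 0 \<le> cyl_weight s G X"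
  proof (rule AE_I'[OF null_sets_lborel_fst[OF N(1)]])
    show "{X \<in> space lborel. \<not> (X \<in> cyl \<Omega> \<longrightarrow> 0 \<le> cyl_weight s G X)} \<subseteq> fst -` N"
      using N(2) by (fastforce simp: cyl_def cyl_weight_def mult_less_0_iff not_le)
  qed
  then show "AE X in lebesgue. X \<in> cyl \<Omega> \<longrightarrow> 0 \<le> cyl_weight s G X"
    by (rule AE_completion)
qed


section \<open>The spaces on the cylinder\<close>

locale weighted_cylinder = weighted_domain "cyl \<Omega>" w
  for \<Omega> :: "'a::euclidean_space set" and w :: "'a \<times> real \<Rightarrow> real"
begin

abbreviation T :: "('a \<times> real \<Rightarrow> real) ipspace" where
  "T \<equiv> test_space \<Omega> w"

abbreviation W0 :: "('a \<times> real \<Rightarrow> real) set" where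
  "W0 \<equiv> {u \<in> Cc_infty (cyl \<Omega>). grad u \<in> L2_weighted (cyl \<Omega>) w}"

lemma test_space_ops [simp]:
  "vadd T u v = (\<lambda>X. u X + v X)"
  "vscale T c u = (\<lambda>X. c * u X)"
  "ip T u v = (LINT X:cyl \<Omega>|lebesgue. w X * (grad u X \<bullet> grad v X))"
  by (simp_all add: test_space_def)

lemma in_test_space:
  "u \<in> vset T \<longleftrightarrow> C_infty_closure (cyl \<Omega>) u \<and> compact (supp u) \<and> supp u \<subseteq> cyl_bottom \<Omega> \<and>
    grad u \<in> L2_weighted (cyl \<Omega>) w"
  by (auto simp: test_space_def Cc_infty_cyl_def)

lemma test_space_smooth: "u \<in> vset T \<Longrightarrow> C_infty (cyl \<Omega>) u"
  by (simp add: in_test_space C_infty_closure_def)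

lemma test_space_L2: "u \<in> vset T \<Longrightarrow> grad u \<in> L2_weighted (cyl \<Omega>) w"
  by (simp add: in_test_space)

lemma test_space_lincomb:
  assumes u: "u \<in> vset T" and v: "v \<in> vset T"
  shows "(\<lambda>X. a * u X + b * v X) \<in> vset T"
  unfolding in_test_space
proof (intro conjI)
  show "C_infty_closure (cyl \<Omega>) (\<lambda>X. a * u X + b * v X)"
    using u v unfolding in_test_space by (intro C_infty_closure_lincomb open_U) blast+
  show "compact (supp (\<lambda>X. a * u X + b * v X))"
    using u v unfolding in_test_space by (intro compact_supp_lincomb) blast+
  show "supp (\<lambda>X. a * u X + b * v X) \<subseteq> cyl_bottom \<Omega>"
    using u v supp_lincomb[of a u b v] unfolding in_test_space by blast
  show "grad (\<lambda>X. a * u X + b * v X) \<in> L2_weighted (cyl \<Omega>) w"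
    by (rule L2_weighted_lincomb[OF test_space_L2[OF u] test_space_L2[OF v]])
      (rule grad_lincomb[OF open_U test_space_smooth[OF u] test_space_smooth[OF v]])
qed

lemma W0_lincomb:
  assumes u: "u \<in> W0" and v: "v \<in> W0"
  shows "(\<lambda>X. a * u X + b * v X) \<in> W0"
proof -
  have s: "C_infty (cyl \<Omega>) u" "C_infty (cyl \<Omega>) v" using u v by (auto simp: Cc_infty_def)
  have "C_infty (cyl \<Omega>) (\<lambda>X. a * u X + b * v X)" by (intro C_infty_lincomb open_U s)
  moreover have "compact (supp (\<lambda>X. a * u X + b * v X))"
    using u v by (intro compact_supp_lincomb) (auto simp: Cc_infty_def)
  moreover have "supp (\<lambda>X. a * u X + b * v X) \<subseteq> cyl \<Omega>"
    using u v supp_lincomb[of a u b v] unfolding Cc_infty_def by blast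
  moreover have "grad (\<lambda>X. a * u X + b * v X) \<in> L2_weighted (cyl \<Omega>) w"
    using u v by (intro L2_weighted_lincomb[OF _ _ grad_lincomb[OF open_U s]]) blast+
  ultimately show ?thesis by (simp add: Cc_infty_def)
qed

lemma zero_in: "(\<lambda>_. 0) \<in> vset T" "(\<lambda>_. 0) \<in> W0"
  by (simp_all add: in_test_space Cc_infty_def C_infty_closure_zero C_infty_zero supp_zero grad_zero
      L2_weighted_zero)

lemma ip_test_space_lincomb:
  assumes u: "u \<in> vset T" and v: "v \<in> vset T" and z: "z \<in> vset T"
  shows "ip T (\<lambda>X. a * u X + b * v X) z = a * ip T u z + b * ip T v z"
proof -
  have *: "set_integrable lebesgue (cyl \<Omega>) (\<lambda>X. c * (w X * (grad x X \<bullet> grad z X)))"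
    if "x \<in> vset T" for x c
    by (intro set_integrable_mult_right weighted_inner_integrable test_space_L2 that z)
  have "ip T (\<lambda>X. a * u X + b * v X) z =
      (LINT X:cyl \<Omega>|lebesgue. a * (w X * (grad u X \<bullet> grad z X)) + b * (w X * (grad v X \<bullet> grad z X)))"
    unfolding test_space_ops
  proof (rule set_lebesgue_integral_cong[OF U_lebesgue], intro allI impI)
    fix X assume "X \<in> cyl \<Omega>"
    from grad_lincomb[OF open_U test_space_smooth[OF u] test_space_smooth[OF v] this, of a b]
    show "w X * (grad (\<lambda>X. a * u X + b * v X) X \<bullet> grad z X) =
        a * (w X * (grad u X \<bullet> grad z X)) + b * (w X * (grad v X \<bullet> grad z X))"
      by (simp add: inner_add_left algebra_simps)
  qed
  also have "\<dots> = a * ip T u z + b * ip T v z"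
    unfolding test_space_ops using set_integral_add(2)[OF *[OF u, of a] *[OF v, of b]] by simp
  finally show ?thesis .
qed

lemma test_space_semi_inner_space: "semi_inner_space T"
proof
  show "vset T \<noteq> {}" using zero_in(1) by blast
next
  fix u v assume u: "u \<in> vset T" and v: "v \<in> vset T"
  show "vadd T u v \<in> vset T" using test_space_lincomb[OF u v, of 1 1] by simp
  show "ip T u v = ip T v u" by (simp add: inner_commute)
  show "ip T (vscale T c u) v = c * ip T u v" for c
    using ip_test_space_lincomb[OF u u v, of c 0] by simp
  show "ip T (vadd T u v) z = ip T u z + ip T v z" if "z \<in> vset T" for z
    using ip_test_space_lincomb[OF u v that, of 1 1] by simp
next
  fix u c assume u: "u \<in> vset T"
  show "vscale T c u \<in> vset T" using test_space_lincomb[OF u u, of c 0] by simp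
  show "0 \<le> ip T u u"
    unfolding test_space_ops set_lebesgue_integral_def
  proof (rule integral_nonneg_AE)
    show "AE X in lebesgue. 0 \<le> indicat_real (cyl \<Omega>) X *\<^sub>R (w X * (grad u X \<bullet> grad u X))"
      using w_nonneg by eventually_elim (simp add: indicator_def)
  qed
qed

lemma hilbert_quotient_L0L: "hilbert_quotient (L0L \<Omega> w) (L0 \<Omega> w)"
proof -
  interpret semi_inner_space T by (rule test_space_semi_inner_space)
  show ?thesis
    unfolding L0L_def L0_def
  proof (rule completion_sub_quotient)
    show "W0 \<inter> vset T \<noteq> {}" using zero_in by blast
    show "vadd T u v \<in> W0" if "u \<in> W0 \<inter> vset T" "v \<in> W0 \<inter> vset T" for u v
      using W0_lincomb[of u v 1 1] that by simp
    show "vscale T r u \<in> W0" if "u \<in> W0 \<inter> vset T" for u r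
      using W0_lincomb[of u u r 0] that by simp
  qed
qed

end

text \<open>
  For the spaces on the cylinder, the extension is the minimal representative and the fractional
  Laplacian is the Riesz map of the quotient, so the abstract theorem applies.
\<close>

theorem theorem4p7:
  fixes \<Omega> :: "'a::euclidean_space set"
    and s G :: "'a \<Rightarrow> real"
    and w :: "'a \<times> real \<Rightarrow> real"
    and h :: "'a L_elem set \<Rightarrow> real"
  assumes "open \<Omega>" and "bounded \<Omega>" and "\<Omega> \<noteq> {}"
    and "admissible \<Omega> s G"
    and "w = cyl_weight s G"
    and "h \<in> dual (X_space \<Omega> w)"
  shows "(\<exists>!v. v \<in> vset (X_space \<Omega> w) \<and> frac_laplacian \<Omega> w v = h) \<and>
         (\<exists>u. is_arg_min (J_functional \<Omega> w h) (\<lambda>u. u \<in> vset (L0L \<Omega> w)) u) \<and>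
         (\<forall>u. is_arg_min (J_functional \<Omega> w h) (\<lambda>u. u \<in> vset (L0L \<Omega> w)) u \<longrightarrow>
            Tr \<Omega> w u \<in> vset (X_space \<Omega> w) \<and> frac_laplacian \<Omega> w (Tr \<Omega> w u) = h)"
proof -
  interpret weighted_cylinder \<Omega> w
    unfolding weighted_cylinder_def \<open>w = cyl_weight s G\<close>
    by (rule cylinder_weighted_domain[OF \<open>open \<Omega>\<close> \<open>admissible \<Omega> s G\<close>])
  interpret Q: hilbert_quotient "L0L \<Omega> w" "L0 \<Omega> w" by (rule hilbert_quotient_L0L)
  have Tr: "Tr \<Omega> w = Q.q" by (simp add: Tr_def fun_eq_iff)
  have S: "S_ext \<Omega> w = Q.min_rep"
    by (rule ext) (simp only: S_ext_def Q.min_rep_def Tr)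
  have L: "frac_laplacian \<Omega> w = Q.riesz_op"
    by (rule ext) (simp only: frac_laplacian_def Q.riesz_op_def Tr S X_space_def)
  have J: "J_functional \<Omega> w h = (\<lambda>u. 1 / 2 * (ipnorm (L0L \<Omega> w) u)\<^sup>2 - h (Q.q u))"
    by (rule ext) (simp only: J_functional_def Tr)
  have "h \<in> dual Q.X" using \<open>h \<in> dual (X_space \<Omega> w)\<close> by (simp only: X_space_def)
  from Q.riesz_op_solution[OF this] show ?thesis
    unfolding L J Tr X_space_def by blast
qed

end
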